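(* Let $J\subsetneq I\subset S=K[x_1,\ldots,x_n]$ be monomial ideals, and let $g$ and the characteristic poset $P^g_{I/J}$ be as in the context. Let $\mathcal{P}:\ P^g_{I/J}=\bigcup_{i=1}^r[c_i,d_i]$ be a partition of $P^g_{I/J}$ into intervals with the property that for all $j=1,\ldots,r$ the union $\bigcup_{i=1}^j[c_i,d_i]$ is a poset ideal of $P^g_{I/J}$. Then the Stanley decomposition $\mathcal{D}(\mathcal{P})$ of $I/J$ is induced by a prime filtration of $I/J$.
   Context: $K$ is a field and $S=K[x_1,\ldots,x_n]$ with its $\mathbb{Z}^n$-grading. For a finitely generated $\mathbb{Z}^n$-graded $S$-module $M$, a homogeneous $u\in M$ and $Z\subset\{x_1,\ldots,x_n\}$, $uK[Z]$ denotes the $K$-subspace of $M$ generated by all $uv$ with $v$ a monomial in $K[Z]$; it is a Stanley space of dimension $|Z|$ if it is a free $K[Z]$-module. A Stanley decomposition of $M$ is a presentation $M=\bigoplus_{i=1}^m u_iK[Z_i]$ of $M$ as a finite direct sum of Stanley spaces, as $\mathbb{Z}^n$-graded $K$-vector spaces. A prime filtration of $M$ is a chain of $\mathbb{Z}^n$-graded submodules $0=M_0\subset M_1\subset\cdots\subset M_m=M$ with $M_i/M_{i-1}\cong(S/P_i)(-a_i)$, $a_i\in\mathbb{Z}^n$, $P_i$ a monomial prime ideal. It gives rise to Stanley decompositions $M=\bigoplus_{i=1}^m u_iK[Z_i]$, where $u_i\in M_i$ is homogeneous of degree $a_i$ with residue class generating $M_i/M_{i-1}$ and $Z_i=\{x_j: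 x_j\notin P_i\}$; a Stanley decomposition is said to be induced by a prime filtration if, after renumbering its summands, it arises in this way. For $a\in\mathbb{N}^n$ (with $0\in\mathbb{N}$), $x^a=x_1^{a(1)}\cdots x_n^{a(n)}$; $\mathbb{N}^n$ is partially ordered componentwise. Let $I$ be generated by monomials $x^{a_1},\ldots,x^{a_t}$ and $J$ by monomials $x^{b_1},\ldots,x^{b_s}$ (no $b_j$'s if $J=0$). Fix $g\in\mathbb{N}^n$ with $a_i\le g$ and $b_j\le g$ for all $i,j$. The characteristic poset of $I/J$ with respect to $g$ is $P^g_{I/J}=\{c\in\mathbb{N}^n: c\le g,\ a_i\le c \text{ for some } i,\ c\not\ge b_j\text{ for all } j\}$, a finite subposet of $\mathbb{N}^n$. For $a\le b$ in a poset $P$, $[a,b]=\{c\in P: a\le c\le b\}$ is an interval; a partition of a finite poset $P$ is a presentation $P=\bigcup_{i=1}^r[a_i,b_i]$ as a disjoint union of (nonempty) intervals. A poset ideal of $P$ here means an upward closed subset: $A\subset P$ such that $a\in A$, $e\in P$, $e\ge a$ imply $e\in A$. For $b\in P^g_{I/J}$ set $Z_b=\{x_j: b(j)=g(j)\}$. The module $I/J$ is identified with the $K$-span of the monomials in $I\setminus J$. A partition $\mathcal{P}: P^g_{I/J}=\bigcup_{i=1}^r[c_i,d_i]$ gives the Stanley decomposition $\mathcal{D}(\mathcal{P}): I/J=\bigoplus_{i=1}^r\big(\bigoplus_c x^cK[Z_{d_i}]\big)$, where the inner sum is over all $c\in[c_i,d_i]$ with $c(j)=c_i(j)$ for all $j$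 with $x_j\in Z_{d_i}$. *)

theory Defs
  imports
    "HOL-Algebra.Module"
    "HOL-Algebra.Algebraic_Closure_Type"
    "HOL-Library.Poly_Mapping"
    "HOL-Library.FuncSet"
    "HOL-Analysis.Finite_Cartesian_Product"
begin

section \<open>The polynomial ring and its monomials\<close>

text \<open>
  The variables \<open>x\<^sub>1, \<dots>, x\<^sub>n\<close> are indexed by a finite type \<open>'n\<close>. Exponent vectors are elements
  of \<open>nat ^ 'n\<close>, whose library order is the componentwise one, and \<open>S = K[x\<^sub>1, \<dots>, x\<^sub>n]\<close> is the
  monoid algebra of finitely supported functions with the convolution product.
\<close>

type_synonym ('k, 'n) mpol = "(nat ^ 'n) \<Rightarrow>\<^sub>0 'k"

abbreviation pol_ring :: "('k::field, 'n::finite) mpol ring" where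
  "pol_ring \<equiv> ring_of_type_algebra"

definition mon :: "nat ^ 'n \<Rightarrow> ('k::field, 'n::finite) mpol" where
  "mon a = Poly_Mapping.single a 1"

definition const_pol :: "'k \<Rightarrow> ('k::field, 'n::finite) mpol" where
  "const_pol k = Poly_Mapping.single 0 k"

definition mon_supported :: "'n set \<Rightarrow> (nat ^ 'n::finite) set" where
  "mon_supported Z = {a. \<forall>j. a $ j \<noteq> 0 \<longrightarrow> j \<in> Z}"

text \<open>The subalgebra \<open>K[Z]\<close> of \<open>S\<close>.\<close>
definition sub_pol :: "'n set \<Rightarrow> ('k::field, 'n::finite) mpol set" where
  "sub_pol Z = {p. Poly_Mapping.keys p \<subseteq> mon_supported Z}"

definition gen_mon_ideal :: "(nat ^ 'n) set \<Rightarrow> ('k::field, 'n::finite) mpol set" where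
  "gen_mon_ideal A = Idl\<^bsub>pol_ring\<^esub> (mon ` A)"

definition monomial_prime :: "('k::field, 'n::finite) mpol set \<Rightarrow> bool" where
  "monomial_prime P \<longleftrightarrow> primeideal P pol_ring \<and> (\<exists>A. P = gen_mon_ideal A)"


section \<open>Graded modules\<close>

text \<open>
  An \<open>S\<close>-module together with its family of homogeneous components, indexed by \<open>int ^ 'n\<close>.
  The fields \<open>mult\<close> and \<open>one\<close> inherited from the library's record of modules are irrelevant.
\<close>
record ('k::zero, 'n::finite, 'b) gmod = "(('k, 'n) mpol, 'b) module" +
  hcomp :: "int ^ 'n \<Rightarrow> 'b set"

definition K_subspace :: "('k::field, 'n::finite, 'b) gmod \<Rightarrow> 'b set \<Rightarrow> bool" where
  "K_subspace M V \<longleftrightarrow> subgroup V (add_monoid M) \<and>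
     (\<forall>k. \<forall>v\<in>V. const_pol k \<odot>\<^bsub>M\<^esub> v \<in> V)"

definition K_span :: "('k::field, 'n::finite, 'b) gmod \<Rightarrow> 'b set \<Rightarrow> 'b set" where
  "K_span M G = \<Inter>{V. K_subspace M V \<and> G \<subseteq> V}"

text \<open>\<open>M\<close> is the internal direct sum of the \<open>K\<close>-subspaces \<open>V i\<close>, \<open>i \<in> Ix\<close>.\<close>
definition direct_sum ::
    "('k::field, 'n::finite, 'b) gmod \<Rightarrow> 'i set \<Rightarrow> ('i \<Rightarrow> 'b set) \<Rightarrow> bool" where
  "direct_sum M Ix V \<longleftrightarrow>
     (\<forall>i\<in>Ix. K_subspace M (V i)) \<and>
     (\<forall>x\<in>carrier M. \<exists>!f. f \<in> (\<Pi>\<^sub>E i\<in>Ix. V i) \<and> finite {i\<in>Ix. f i \<noteq> \<zero>\<^bsub>M\<^esub>} \<and>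
        x = (\<Oplus>\<^bsub>M\<^esub> i\<in>{i\<in>Ix. f i \<noteq> \<zero>\<^bsub>M\<^esub>}. f i))"

definition graded_pol :: "int ^ 'n \<Rightarrow> ('k::field, 'n::finite) mpol set" where
  "graded_pol a = {p. \<forall>b\<in>Poly_Mapping.keys p. \<forall>j. int (b $ j) = a $ j}"

definition graded_module :: "('k::field, 'n::finite, 'b) gmod \<Rightarrow> bool" where
  "graded_module M \<longleftrightarrow> module pol_ring M \<and> direct_sum M UNIV (hcomp M) \<and>
     (\<forall>a b. \<forall>p\<in>graded_pol a. \<forall>x\<in>hcomp M b. p \<odot>\<^bsub>M\<^esub> x \<in> hcomp M (a + b))"

definition pol_gmod :: "('k::field, 'n::finite, ('k, 'n) mpol) gmod" where
  "pol_gmod = \<lparr>carrier = UNIV, monoid.mult = (*), one = 1, ring.zero = 0, add = (+), module.smult = (*),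
     hcomp = graded_pol\<rparr>"

definition sub_gmod ::
    "('k::field, 'n::finite, 'b) gmod \<Rightarrow> 'b set \<Rightarrow> ('k, 'n, 'b) gmod" where
  "sub_gmod M N = M\<lparr>carrier := N, hcomp := \<lambda>a. N \<inter> hcomp M a\<rparr>"

definition graded_submodule :: "('k::field, 'n::finite, 'b) gmod \<Rightarrow> 'b set \<Rightarrow> bool" where
  "graded_submodule M N \<longleftrightarrow> submodule N pol_ring M \<and> graded_module (sub_gmod M N)"

text \<open>
  The quotient \<open>M/N\<close>, on the set of cosets of \<open>N\<close>; scalar multiplication follows the pattern of
  \<^const>\<open>rcoset_mult\<close> and sends \<open>N + x\<close> to \<open>N + p x\<close>.
\<close>
definition quot_gmod ::
    "('k::field, 'n::finite, 'b) gmod \<Rightarrow> 'b set \<Rightarrow> ('k, 'n, 'b set) gmod" where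
  "quot_gmod M N =
     \<lparr>carrier = a_rcosets\<^bsub>M\<^esub> N, monoid.mult = undefined, one = undefined,
      ring.zero = N, add = set_add M,
      module.smult = (\<lambda>p C. \<Union>x\<in>C. N +>\<^bsub>M\<^esub> (p \<odot>\<^bsub>M\<^esub> x)),
      hcomp = (\<lambda>a. (\<lambda>x. N +>\<^bsub>M\<^esub> x) ` hcomp M a)\<rparr>"

text \<open>The twist \<open>M(-a)\<close>, whose component in degree \<open>b\<close> is that of \<open>M\<close> in degree \<open>b - a\<close>.\<close>
definition shift_gmod ::
    "('k::field, 'n::finite, 'b) gmod \<Rightarrow> int ^ 'n \<Rightarrow> ('k, 'n, 'b) gmod" where
  "shift_gmod M a = M\<lparr>hcomp := \<lambda>b. hcomp M (b - a)\<rparr>"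

definition gmod_iso ::
    "('k::field, 'n::finite, 'b) gmod \<Rightarrow> ('k, 'n, 'c) gmod \<Rightarrow> bool" where
  "gmod_iso M N \<longleftrightarrow> (\<exists>f. bij_betw f (carrier M) (carrier N) \<and>
     (\<forall>x\<in>carrier M. \<forall>y\<in>carrier M. f (x \<oplus>\<^bsub>M\<^esub> y) = f x \<oplus>\<^bsub>N\<^esub> f y) \<and>
     (\<forall>p. \<forall>x\<in>carrier M. f (p \<odot>\<^bsub>M\<^esub> x) = p \<odot>\<^bsub>N\<^esub> f x) \<and>
     (\<forall>a. f ` hcomp M a = hcomp N a))"


section \<open>Stanley decompositions\<close>

text \<open>The subspace \<open>uK[Z]\<close>.\<close>
definition stanley_set :: "('k::field, 'n::finite, 'b) gmod \<Rightarrow> 'b \<Rightarrow> 'n set \<Rightarrow> 'b set" where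
  "stanley_set M u Z = K_span M {mon a \<odot>\<^bsub>M\<^esub> u | a. a \<in> mon_supported Z}"

text \<open>\<open>V\<close> is a free module over the subring \<open>R\<close> of \<open>S\<close>, with some basis \<open>B\<close>.\<close>
definition free_over ::
    "('k::field, 'n::finite, 'b) gmod \<Rightarrow> ('k, 'n) mpol set \<Rightarrow> 'b set \<Rightarrow> bool" where
  "free_over M R V \<longleftrightarrow>
     subgroup V (add_monoid M) \<and> (\<forall>p\<in>R. \<forall>v\<in>V. p \<odot>\<^bsub>M\<^esub> v \<in> V) \<and>
     (\<exists>B\<subseteq>V. \<forall>v\<in>V. \<exists>!f. f \<in> B \<rightarrow>\<^sub>E R \<and> finite {b\<in>B. f b \<noteq> 0} \<and>
        v = (\<Oplus>\<^bsub>M\<^esub> b\<in>{b\<in>B. f b \<noteq> 0}. f b \<odot>\<^bsub>M\<^esub> b))"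

text \<open>
  A Stanley space \<open>uK[Z]\<close> has dimension \<open>card Z\<close>, so the zero space (\<open>u = 0\<close>, free of rank 0) is
  not one.
\<close>
definition stanley_space :: "('k::field, 'n::finite, 'b) gmod \<Rightarrow> 'b \<Rightarrow> 'n set \<Rightarrow> bool" where
  "stanley_space M u Z \<longleftrightarrow>
     (\<exists>a. u \<in> hcomp M a) \<and> u \<noteq> \<zero>\<^bsub>M\<^esub> \<and> free_over M (sub_pol Z) (stanley_set M u Z)"

text \<open>
  A Stanley decomposition is given by a finite family of pairs \<open>(u i, Z i)\<close>; the index set is
  arbitrary, as the order of the summands does not matter.
\<close>
definition stanley_decomposition ::
    "('k::field, 'n::finite, 'b) gmod \<Rightarrow> 'i set \<Rightarrow> ('i \<Rightarrow> 'b) \<Rightarrow> ('i \<Rightarrow> 'n set) \<Rightarrow> bool" where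
  "stanley_decomposition M Ix u Z \<longleftrightarrow> finite Ix \<and>
     (\<forall>i\<in>Ix. stanley_space M (u i) (Z i)) \<and>
     direct_sum M Ix (\<lambda>i. stanley_set M (u i) (Z i))"


section \<open>Prime filtrations\<close>

abbreviation subquot ::
    "('k::field, 'n::finite, 'b) gmod \<Rightarrow> 'b set \<Rightarrow> 'b set \<Rightarrow> ('k, 'n, 'b set) gmod" where
  "subquot M L N \<equiv> quot_gmod (sub_gmod M L) N"

definition prime_filtration ::
    "('k::field, 'n::finite, 'b) gmod \<Rightarrow> nat \<Rightarrow> (nat \<Rightarrow> 'b set) \<Rightarrow>
     (nat \<Rightarrow> ('k, 'n) mpol set) \<Rightarrow> (nat \<Rightarrow> int ^ 'n) \<Rightarrow> bool" where
  "prime_filtration M m F P a \<longleftrightarrow>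
     F 0 = {\<zero>\<^bsub>M\<^esub>} \<and> F m = carrier M \<and>
     (\<forall>i\<in>{0..m}. graded_submodule M (F i)) \<and>
     (\<forall>i\<in>{1..m}. F (i - 1) \<subset> F i \<and> monomial_prime (P i) \<and>
        gmod_iso (subquot M (F i) (F (i - 1))) (shift_gmod (quot_gmod pol_gmod (P i)) (a i)))"

text \<open>
  The decomposition \<open>(u i, Z i)\<close>, \<open>i \<in> Ix\<close>, is induced by a prime filtration if the bijection
  \<open>\<sigma>\<close> renumbers its summands so that they arise from the successive quotients.
\<close>
definition induced_by_prime_filtration ::
    "('k::field, 'n::finite, 'b) gmod \<Rightarrow> 'i set \<Rightarrow> ('i \<Rightarrow> 'b) \<Rightarrow> ('i \<Rightarrow> 'n set) \<Rightarrow> bool" where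
  "induced_by_prime_filtration M Ix u Z \<longleftrightarrow>
     stanley_decomposition M Ix u Z \<and>
     (\<exists>m F P a \<sigma>. prime_filtration M m F P a \<and> bij_betw \<sigma> {1..m} Ix \<and>
        (\<forall>i\<in>{1..m}.
           u (\<sigma> i) \<in> F i \<inter> hcomp M (a i) \<and>
           carrier (subquot M (F i) (F (i - 1))) =
             range (\<lambda>p. p \<odot>\<^bsub>subquot M (F i) (F (i - 1))\<^esub> (F (i - 1) +>\<^bsub>M\<^esub> u (\<sigma> i))) \<and>
           Z (\<sigma> i) = {j. mon (axis j 1) \<notin> P i}))"


section \<open>The characteristic poset\<close>

text \<open>\<open>A\<close> and \<open>B\<close> are the sets of exponents of the generators of \<open>I\<close> and \<open>J\<close>.\<close>
definition char_poset ::
    "(nat ^ 'n) set \<Rightarrow> (nat ^ 'n) set \<Rightarrow> nat ^ 'n \<Rightarrow> (nat ^ 'n::finite) set" where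
  "char_poset A B g = {c. c \<le> g \<and> (\<exists>a\<in>A. a \<le> c) \<and> (\<forall>b\<in>B. \<not> b \<le> c)}"

definition poset_interval :: "'a::order set \<Rightarrow> 'a \<Rightarrow> 'a \<Rightarrow> 'a set" where
  "poset_interval P a b = {c\<in>P. a \<le> c \<and> c \<le> b}"

definition interval_partition ::
    "'a::order set \<Rightarrow> nat \<Rightarrow> (nat \<Rightarrow> 'a) \<Rightarrow> (nat \<Rightarrow> 'a) \<Rightarrow> bool" where
  "interval_partition P r c d \<longleftrightarrow>
     (\<forall>i\<in>{1..r}. c i \<in> P \<and> d i \<in> P \<and> c i \<le> d i) \<and>
     disjoint_family_on (\<lambda>i. poset_interval P (c i) (d i)) {1..r} \<and>
     P = (\<Union>i\<in>{1..r}. poset_interval P (c i) (d i))"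

definition poset_ideal :: "'a::order set \<Rightarrow> 'a set \<Rightarrow> bool" where
  "poset_ideal P A \<longleftrightarrow> A \<subseteq> P \<and> (\<forall>a\<in>A. \<forall>e\<in>P. a \<le> e \<longrightarrow> e \<in> A)"

definition Z_of :: "nat ^ 'n \<Rightarrow> nat ^ 'n \<Rightarrow> 'n::finite set" where
  "Z_of g b = {j. b $ j = g $ j}"

text \<open>
  The family \<open>\<D>(\<P>)\<close> is indexed by the pairs \<open>(i, e)\<close> with \<open>e \<in> [c i, d i]\<close> agreeing with \<open>c i\<close> on
  \<open>Z\<^sub>d\<^sub>i\<close>; its members are the residue class of \<open>x\<^sup>e\<close> in \<open>I/J\<close> and the set \<open>Z\<^sub>d\<^sub>i\<close>.
\<close>
definition DP_index ::
    "(nat ^ 'n) set \<Rightarrow> nat ^ 'n \<Rightarrow> nat \<Rightarrow> (nat \<Rightarrow> nat ^ 'n) \<Rightarrow> (nat \<Rightarrow> nat ^ 'n) \<Rightarrow>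
     (nat \<times> (nat ^ 'n::finite)) set" where
  "DP_index P g r c d =
     {(i, e). i \<in> {1..r} \<and> e \<in> poset_interval P (c i) (d i) \<and>
        (\<forall>j\<in>Z_of g (d i). e $ j = c i $ j)}"

definition DP_elt ::
    "('k::field, 'n::finite) mpol set \<Rightarrow> nat \<times> (nat ^ 'n) \<Rightarrow> ('k, 'n) mpol set" where
  "DP_elt J = (\<lambda>(i, e). J +>\<^bsub>pol_gmod\<^esub> mon e)"

definition DP_vars ::
    "nat ^ 'n \<Rightarrow> (nat \<Rightarrow> nat ^ 'n) \<Rightarrow> nat \<times> (nat ^ 'n) \<Rightarrow> 'n::finite set" where
  "DP_vars g d = (\<lambda>(i, e). Z_of g (d i))"

end

(* Call a set U of exponent vectors up-closed if f in U implies f + s in U.  For up-closed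
   W <= V the spans of the monomials with exponents in V and W are monomial ideals, and all modules
   occurring here (I/J, the steps F_k of the filtration, F_k / F_{k-1}, S/P) are of the form
   span V / span W.  A chain of up-closed sets U_{k-1} <= U_k with
   U_k - U_{k-1} = e + {exponents supported in Z} gives F_k / F_{k-1} = (S/P)(-e) with P generated by the
   variables outside Z, so it is enough to order the pieces x^e K[Z] of the decomposition so that
   every initial union, together with J, is up-closed.  Truncation f |-> min(f, g) sends the exponents
   in I but not in J to the characteristic poset; if f lies in the piece (i, e), a multiple of x^f outside J
   lies in a piece (i', e') with i' < i, by the poset ideal property, or with i' = i and e' >= e.
   Sorting by i and then by decreasing |e| is therefore such an order. *)

theory Submission
  imports Defs
begin

unbundle no fps_syntax

section \<open>Spans of monomials\<close>

text \<open>Since all generators lie below \<open>g\<close>, truncation preserves membership in I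
  and in J, so the exponents of I outside J are divided among the fibres of truncation over the
  intervals. The fibre over [\<open>c i\<close>, \<open>d i\<close>] is a product over the
  coordinates: where \<open>d i\<close> reaches \<open>g\<close>, the coordinate runs through all
  values from \<open>c i\<close> upward; elsewhere \<open>d i\<close> is strictly below
  \<open>g\<close>, truncation changes nothing, and the coordinate runs from \<open>c i\<close> to
  \<open>d i\<close>. Fixing the coordinates of the second kind cuts the fibre into the translates
  x^e K[Z], which is why \<open>e\<close> has to agree with \<open>c i\<close> on Z. A
  multiplication that stays inside the fibre can only raise the fixed coordinates; pieces with
  larger |e| must therefore enter the filtration earlier.\<close>

definition mspan :: "(nat ^ 'n) set \<Rightarrow> ('k::field, 'n::finite) mpol set" where
  "mspan T = {p. Poly_Mapping.keys p \<subseteq> T}"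

definition up_closed :: "(nat ^ 'n::finite) set \<Rightarrow> bool" where
  "up_closed U \<longleftrightarrow> (\<forall>a\<in>U. \<forall>s. a + s \<in> U)"

text \<open>The K-linear projection of S onto \<open>mspan T\<close> along the remaining monomials.
  It selects components of a direct sum and representatives without terms in a given set.\<close>

definition restr :: "(nat ^ 'n) set \<Rightarrow> ('k::field, 'n::finite) mpol \<Rightarrow> ('k, 'n) mpol" where
  "restr T = Poly_Mapping.mapp (\<lambda>k v. v when k \<in> T)"

lemma lookup_restr:
  "Poly_Mapping.lookup (restr T p) k = (Poly_Mapping.lookup p k when k \<in> T)"
  by (simp add: restr_def lookup_mapp when_def in_keys_iff)

lemma mspan_iff: "p \<in> mspan T \<longleftrightarrow> (\<forall>k. k \<notin> T \<longrightarrow> Poly_Mapping.lookup p k = 0)"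
  by (auto simp: mspan_def in_keys_iff)

lemma mspan_lookup: "p \<in> mspan T \<Longrightarrow> k \<notin> T \<Longrightarrow> Poly_Mapping.lookup p k = 0"
  by (simp add: mspan_iff)

lemma mspan_zero [simp]: "0 \<in> mspan T"
  by (simp add: mspan_def)

lemma mspan_add: "p \<in> mspan T \<Longrightarrow> q \<in> mspan T \<Longrightarrow> p + q \<in> mspan T"
  by (simp add: mspan_iff lookup_add)

lemma mspan_uminus: "p \<in> mspan T \<Longrightarrow> - p \<in> mspan T"
  by (simp add: mspan_iff)

lemma mspan_diff: "p \<in> mspan T \<Longrightarrow> q \<in> mspan T \<Longrightarrow> p - q \<in> mspan T"
  by (simp add: mspan_iff lookup_minus)

lemma mspan_sum: "(\<And>i. i \<in> S \<Longrightarrow> p i \<in> mspan T) \<Longrightarrow> sum p S \<in> mspan T"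
  by (induction S rule: infinite_finite_induct) (auto intro: mspan_add)

lemma mspan_mono: "T \<subseteq> Y \<Longrightarrow> mspan T \<subseteq> mspan Y"
  by (auto simp: mspan_def)

lemma mspan_Int: "mspan T \<inter> mspan Y = mspan (T \<inter> Y)"
  by (auto simp: mspan_def)

lemma mspan_empty [simp]: "mspan {} = {0}"
  by (auto simp: mspan_def)

lemma mspan_UNIV [simp]: "mspan UNIV = UNIV"
  by (auto simp: mspan_def)

lemma restr_mspan: "restr T p \<in> mspan T"
  by (simp add: mspan_iff lookup_restr)

lemma restr_mspan_Int: "p \<in> mspan Y \<Longrightarrow> restr T p \<in> mspan (T \<inter> Y)"
  by (auto simp: mspan_iff lookup_restr)

lemma mon_mspan [simp]: "mon a \<in> mspan T \<longleftrightarrow> a \<in> T"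
  by (simp add: mspan_def mon_def)

lemma lookup_mon_mult:
  "Poly_Mapping.lookup (mon e * p) (e + k) = Poly_Mapping.lookup p k"
proof -
  have "Poly_Mapping.lookup (mon e * p) (e + k)
      = (\<Sum>l. ((1::'a) when e = l) * (\<Sum>q. Poly_Mapping.lookup p q when e + k = l + q))"
    by (simp add: lookup_mult mon_def lookup_single)
  also have "\<dots> = Poly_Mapping.lookup p k"
    by (simp add: when_mult)
  finally show ?thesis .
qed

lemma keys_mon_mult: "Poly_Mapping.keys (mon e * p) = (+) e ` Poly_Mapping.keys p"
proof
  show "Poly_Mapping.keys (mon e * p) \<subseteq> (+) e ` Poly_Mapping.keys p"
    using keys_mult[of "mon e" p] by (fastforce simp: mon_def)
  show "(+) e ` Poly_Mapping.keys p \<subseteq> Poly_Mapping.keys (mon e * p)"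
    by (auto simp: in_keys_iff lookup_mon_mult)
qed

lemma mon_mult_mspan: "mon e * p \<in> mspan T \<longleftrightarrow> p \<in> mspan {f. e + f \<in> T}"
  by (auto simp: mspan_def keys_mon_mult)

lemma mon_mult_mon: "mon a * mon b = mon (a + b)"
  by (simp add: mon_def mult_single)

lemma const_pol_mult_mon: "const_pol k * mon a = Poly_Mapping.single a k"
  by (simp add: mon_def const_pol_def mult_single)

lemma lookup_const_pol_mult:
  "Poly_Mapping.lookup (const_pol k * p) a = k * Poly_Mapping.lookup p a"
proof -
  have "Poly_Mapping.lookup (const_pol k * p) a
      = (\<Sum>l. (k when 0 = l) * (\<Sum>q. Poly_Mapping.lookup p q when a = l + q))"
    by (simp add: lookup_mult const_pol_def lookup_single)
  then show ?thesis
    by (simp add: when_mult)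
qed

lemma const_pol_mult_mspan: "p \<in> mspan T \<Longrightarrow> const_pol k * p \<in> mspan T"
  by (simp add: mspan_iff lookup_const_pol_mult)

lemma mspan_mult_up: "up_closed T \<Longrightarrow> p \<in> mspan T \<Longrightarrow> s * p \<in> mspan T"
  using keys_mult[of s p] by (fastforce simp: mspan_def up_closed_def add.commute)

lemma mspan_mult_up_right: "up_closed T \<Longrightarrow> p \<in> mspan T \<Longrightarrow> p * s \<in> mspan T"
  using mspan_mult_up[of T p s] by (simp add: mult.commute)

lemma poly_mapping_sum_single:
  "p = (\<Sum>a\<in>Poly_Mapping.keys p. Poly_Mapping.single a (Poly_Mapping.lookup p a))"
  by (rule poly_mapping_eqI) (auto simp: lookup_sum lookup_single when_def in_keys_iff)

text \<open>Every term of \<open>p\<close> is divisible by x^e; the quotients of the single terms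
  add up to \<open>q\<close>.\<close>

lemma mspan_shift:
  assumes "p \<in> mspan T" and "\<And>f. f \<in> T \<Longrightarrow> e \<le> f"
  obtains q where "p = mon e * q"
proof -
  define S where "S = Poly_Mapping.keys p"
  have "\<exists>q. Poly_Mapping.single a (Poly_Mapping.lookup p a) = mon e * q" if "a \<in> S" for a
  proof -
    have "e \<le> a" using that assms by (auto simp: S_def mspan_def)
    then have "a = e + (\<chi> j. a $ j - e $ j)" by (simp add: vec_eq_iff less_eq_vec_def)
    then have "Poly_Mapping.single a (Poly_Mapping.lookup p a)
        = mon e * Poly_Mapping.single (\<chi> j. a $ j - e $ j) (Poly_Mapping.lookup p a)"
      by (simp add: mon_def mult_single)
    then show ?thesis by blast
  qed
  then obtain Q where Q: "\<And>a. a \<in> S \<Longrightarrow> Poly_Mapping.single a (Poly_Mapping.lookup p a) = mon e * Q a"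
    by metis
  have "p = (\<Sum>a\<in>S. mon e * Q a)"
    using poly_mapping_sum_single[of p] Q by (simp add: S_def)
  then show thesis by (intro that[of "\<Sum>a\<in>S. Q a"]) (simp add: sum_distrib_left)
qed

section \<open>Monomial ideals as spans of up-closed sets\<close>

definition up_set :: "(nat ^ 'n::finite) set \<Rightarrow> (nat ^ 'n) set" where
  "up_set A = {f. \<exists>a\<in>A. a \<le> f}"

lemma vec_le_iff_add: "(a::nat ^ 'n::finite) \<le> b \<longleftrightarrow> (\<exists>s. b = a + s)"
proof
  assume "a \<le> b"
  then have "b = a + (\<chi> j. b $ j - a $ j)" by (simp add: vec_eq_iff less_eq_vec_def)
  then show "\<exists>s. b = a + s" ..
qed (auto simp: less_eq_vec_def)

lemma up_closed_iff: "up_closed U \<longleftrightarrow> (\<forall>a\<in>U. \<forall>b. a \<le> b \<longrightarrow> b \<in> U)"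
  by (auto simp: up_closed_def vec_le_iff_add)

lemma up_closed_up_set: "up_closed (up_set A)"
  unfolding up_closed_iff up_set_def by (blast intro: order_trans)

lemma pol_ring_simps [simp]:
  "carrier pol_ring = UNIV" "monoid.mult pol_ring = (*)" "one pol_ring = 1"
  "zero pol_ring = 0" "add pol_ring = (+)"
  by (simp_all add: ring_of_type_algebra_def)

lemma cring_pol_ring: "cring (pol_ring :: ('k::field, 'n::finite) mpol ring)"
  by (rule cring_from_type_algebra)

lemma ring_pol_ring: "ring (pol_ring :: ('k::field, 'n::finite) mpol ring)"
  by (rule cring.axioms[OF cring_pol_ring])

lemma ideal_mspan:
  assumes "up_closed U"
  shows "ideal (mspan U) (pol_ring :: ('k::field, 'n::finite) mpol ring)"
proof (rule idealI[OF ring_pol_ring])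
  interpret R: ring "pol_ring :: ('k, 'n) mpol ring" by (rule ring_pol_ring)
  have minus: "\<ominus>\<^bsub>pol_ring\<^esub> p = - p" for p :: "('k, 'n) mpol"
    by (rule R.minus_equality) auto
  show "subgroup (mspan U) (add_monoid (pol_ring :: ('k, 'n) mpol ring))"
    by (rule R.add.subgroupI) (use minus in \<open>auto simp: mspan_add mspan_uminus a_inv_def[symmetric] intro: exI[of _ 0] mspan_zero\<close>)
qed (use assms in \<open>auto simp: mspan_mult_up mspan_mult_up_right\<close>)

text \<open>An ideal containing the generators contains every scalar multiple of x^f with f above
  some element of \<open>A\<close>, and hence all sums of such terms. Conversely, the span is itself
  an ideal containing the generators.\<close>

lemma gen_mon_ideal_eq: "gen_mon_ideal A = (mspan (up_set A) :: ('k::field, 'n::finite) mpol set)"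
proof
  have "mon ` A \<subseteq> (mspan (up_set A) :: ('k, 'n) mpol set)" by (auto simp: up_set_def)
  then show "gen_mon_ideal A \<subseteq> (mspan (up_set A) :: ('k, 'n) mpol set)"
    using ideal_mspan[OF up_closed_up_set] by (auto simp: gen_mon_ideal_def genideal_def)
  show "(mspan (up_set A) :: ('k, 'n) mpol set) \<subseteq> gen_mon_ideal A"
  proof
    fix p :: "('k, 'n) mpol" assume p: "p \<in> mspan (up_set A)"
    have "p \<in> I" if I: "ideal I pol_ring" "mon ` A \<subseteq> I" for I
    proof -
      interpret ideal I pol_ring by (rule I)
      have "Poly_Mapping.single f k \<in> I" if "f \<in> up_set A" for f k
      proof -
        obtain a s where "a \<in> A" "f = a + s" using \<open>f \<in> up_set A\<close> by (auto simp: up_set_def vec_le_iff_add)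
        then have "Poly_Mapping.single f k = Poly_Mapping.single s k * mon a" 
          by (simp add: mon_def mult_single add.commute)
        then show ?thesis using I_l_closed[of "mon a"] I(2) \<open>a \<in> A\<close> by auto
      qed
      moreover have "sum h S \<in> I" if "\<And>x. x \<in> S \<Longrightarrow> h x \<in> I" for S and h :: "nat ^ 'n \<Rightarrow> ('k, 'n) mpol"
        using that additive_subgroup.zero_closed[OF is_additive_subgroup]
          additive_subgroup.a_closed[OF is_additive_subgroup] by (induction S rule: infinite_finite_induct) auto
      ultimately show ?thesis
        using p by (subst poly_mapping_sum_single) (simp add: mspan_def subset_iff)
    qed
    then show "p \<in> gen_mon_ideal A" by (auto simp: gen_mon_ideal_def genideal_def)
  qed
qed

lemma zero_mon_supported: "0 \<in> mon_supported Z"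
  by (simp add: mon_supported_def)

lemma sub_pol_eq: "sub_pol Z = mspan (mon_supported Z)"
  by (simp add: sub_pol_def mspan_def)

lemma sub_pol_mult:
  assumes "p \<in> sub_pol Z" "q \<in> sub_pol Z"
  shows "p * q \<in> sub_pol Z"
  unfolding sub_pol_def
proof (intro CollectI subsetI)
  fix k assume "k \<in> Poly_Mapping.keys (p * q)"
  then obtain a b where "k = a + b" "a \<in> mon_supported Z" "b \<in> mon_supported Z"
    using keys_mult[of p q] assms unfolding sub_pol_def by blast
  then show "k \<in> mon_supported Z" by (auto simp: mon_supported_def)
qed

lemma mon_graded: "mon e \<in> graded_pol (\<chi> j. int (e $ j))"
  by (simp add: graded_pol_def mon_def)

text \<open>The exponent set has at most one element and is empty when \<open>a\<close> has a
  negative entry. Homogeneous components are thus spans of monomials too, and the grading can be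
  treated like any other decomposition into such spans.\<close>

lemma graded_pol_eq: "graded_pol a = mspan {b. \<forall>j. int (b $ j) = a $ j}"
  by (auto simp: graded_pol_def mspan_def)

section \<open>Quotients of spans of monomials\<close>

text \<open>
  \<open>\<phi>\<close> induces an isomorphism of graded modules from \<open>mspan V / mspan W\<close> onto \<open>M\<close>. Working with \<open>\<phi>\<close>
  instead of with cosets lets the iterated quotients of a filtration of \<open>I/J\<close> be treated uniformly.
\<close>
locale monomial_presentation =
  fixes M :: "('k::field, 'n::finite, 'b) gmod" (structure)
    and V W :: "(nat ^ 'n) set" and \<phi> :: "('k, 'n) mpol \<Rightarrow> 'b"
  assumes W_subset: "W \<subseteq> V" and up_V: "up_closed V" and up_W: "up_closed W"
    and carrier_eq: "carrier M = \<phi> ` mspan V"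
    and add_eq: "\<And>p q. p \<in> mspan V \<Longrightarrow> q \<in> mspan V \<Longrightarrow> \<phi> (p + q) = \<phi> p \<oplus> \<phi> q"
    and zero_eq: "\<phi> 0 = \<zero>"
    and smult_eq: "\<And>s p. p \<in> mspan V \<Longrightarrow> \<phi> (s * p) = s \<odot> \<phi> p"
    and eq_iff: "\<And>p q. p \<in> mspan V \<Longrightarrow> q \<in> mspan V \<Longrightarrow> \<phi> p = \<phi> q \<longleftrightarrow> p - q \<in> mspan W"
    and hcomp_eq: "\<And>a. hcomp M a = \<phi> ` (mspan V \<inter> graded_pol a)"
begin

lemma eq_iff_lookup:
  "p \<in> mspan V \<Longrightarrow> q \<in> mspan V \<Longrightarrow>
    \<phi> p = \<phi> q \<longleftrightarrow> (\<forall>k. k \<notin> W \<longrightarrow> Poly_Mapping.lookup p k = Poly_Mapping.lookup q k)"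
  by (simp add: eq_iff mspan_iff lookup_minus)

lemma in_carrier [simp]: "p \<in> mspan V \<Longrightarrow> \<phi> p \<in> carrier M"
  by (simp add: carrier_eq)

lemma abelian_group: "abelian_group M"
proof (rule abelian_groupI)
  fix x y z assume "x \<in> carrier M" "y \<in> carrier M" "z \<in> carrier M"
  then obtain p q s where [simp]: "x = \<phi> p" "y = \<phi> q" "z = \<phi> s"
    and pqs: "p \<in> mspan V" "q \<in> mspan V" "s \<in> mspan V"
    by (auto simp: carrier_eq)
  show "x \<oplus> y \<in> carrier M" and "x \<oplus> y \<oplus> z = x \<oplus> (y \<oplus> z)" and "x \<oplus> y = y \<oplus> x"
    using pqs by (simp_all add: mspan_add ac_simps flip: add_eq)
next
  fix x assume "x \<in> carrier M"
  then obtain p where [simp]: "x = \<phi> p" and p: "p \<in> mspan V" by (auto simp: carrier_eq)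
  show "\<zero> \<oplus> x = x"
    using p by (simp flip: zero_eq add_eq)
  show "\<exists>y\<in>carrier M. y \<oplus> x = \<zero>"
    using p by (intro bexI[of _ "\<phi> (- p)"]) (simp_all add: mspan_uminus flip: zero_eq add_eq)
qed (simp flip: zero_eq)

lemma a_inv_eq: "p \<in> mspan V \<Longrightarrow> \<ominus> \<phi> p = \<phi> (- p)"
proof -
  assume p: "p \<in> mspan V"
  interpret abelian_group M by (rule abelian_group)
  show ?thesis
    using p by (intro minus_equality) (simp_all add: mspan_uminus flip: zero_eq add_eq)
qed

lemma module: "module pol_ring M"
proof (rule moduleI[OF cring_pol_ring abelian_group])
  fix s t :: "('k, 'n) mpol" and x y assume "x \<in> carrier M" "y \<in> carrier M"
  then obtain p q where [simp]: "x = \<phi> p" "y = \<phi> q" and pq: "p \<in> mspan V" "q \<in> mspan V"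
    by (auto simp: carrier_eq)
  have st: "s * p \<in> mspan V" "s * q \<in> mspan V" "t * p \<in> mspan V"
    using pq up_V by (auto intro: mspan_mult_up)
  show "s \<odot> x \<in> carrier M" using st pq by (simp flip: smult_eq)
  show "(s \<oplus>\<^bsub>pol_ring\<^esub> t) \<odot> x = s \<odot> x \<oplus> t \<odot> x"
    using st pq by (simp add: distrib_right flip: smult_eq add_eq)
  show "s \<odot> (x \<oplus> y) = s \<odot> x \<oplus> s \<odot> y"
    using st pq by (simp add: distrib_left mspan_add flip: smult_eq add_eq)
  show "(s \<otimes>\<^bsub>pol_ring\<^esub> t) \<odot> x = s \<odot> (t \<odot> x)"
    using st pq by (simp add: mult.assoc flip: smult_eq)
  show "\<one>\<^bsub>pol_ring\<^esub> \<odot> x = x"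
    using pq by (simp flip: smult_eq)
qed

lemma finsum_eq:
  assumes "\<And>i. i \<in> S \<Longrightarrow> p i \<in> mspan V"
  shows "(\<Oplus>i\<in>S. \<phi> (p i)) = \<phi> (sum p S)"
proof -
  interpret abelian_group M by (rule abelian_group)
  show ?thesis
    using assms
  proof (induction S rule: infinite_finite_induct)
    case (insert i S)
    then have "(\<Oplus>i\<in>insert i S. \<phi> (p i)) = \<phi> (p i) \<oplus> (\<Oplus>i\<in>S. \<phi> (p i))"
      by (intro finsum_insert) auto
    then show ?case
      using insert by (simp add: add_eq mspan_sum)
  qed (simp_all add: zero_eq)
qed

lemma subgroup_image:
  assumes "T \<subseteq> V"
  shows "subgroup (\<phi> ` mspan T) (add_monoid M)"
proof -
  interpret abelian_group M by (rule abelian_group)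
  have T: "p \<in> mspan V" if "p \<in> mspan T" for p :: "('k, 'n) mpol"
    using assms that mspan_mono by blast
  show ?thesis
  proof (rule add.subgroupI)
    show "\<phi> ` mspan T \<subseteq> carrier M" using T by auto
    show "\<phi> ` mspan T \<noteq> {}" using mspan_zero by blast
    fix x y assume "x \<in> \<phi> ` mspan T" "y \<in> \<phi> ` mspan T"
    then obtain p q where [simp]: "x = \<phi> p" "y = \<phi> q" and pq: "p \<in> mspan T" "q \<in> mspan T"
      by auto
    show "x \<oplus> y \<in> \<phi> ` mspan T"
      using pq T by (auto intro: mspan_add simp flip: add_eq)
  next
    fix x assume "x \<in> \<phi> ` mspan T"
    then obtain p where [simp]: "x = \<phi> p" and pq: "p \<in> mspan T" by auto
    show "\<ominus> x \<in> \<phi> ` mspan T"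
      using pq T by (auto intro: mspan_uminus simp: a_inv_eq)
  qed
qed

lemma K_subspace_image:
  assumes "T \<subseteq> V"
  shows "K_subspace M (\<phi> ` mspan T)"
  unfolding K_subspace_def
proof (intro conjI allI ballI)
  fix k x assume "x \<in> \<phi> ` mspan T"
  then obtain p where p: "x = \<phi> p" "p \<in> mspan T" by auto
  then have "const_pol k \<odot> x = \<phi> (const_pol k * p)"
    using assms mspan_mono[of T V] by (auto simp: smult_eq)
  then show "const_pol k \<odot> x \<in> \<phi> ` mspan T"
    using p by (auto intro: const_pol_mult_mspan)
qed (rule subgroup_image[OF assms])

text \<open>The components of the class of p are the classes of its restrictions to the sets
  \<open>T i\<close>; reading off coefficients outside \<open>W\<close> shows that no other choice
  is possible. The \<open>T i\<close> may meet \<open>W\<close> and may be infinitely many, so the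
  lemma serves both for the grading and for Stanley decompositions.\<close>

lemma direct_sum_image:
  assumes sub: "\<And>i. i \<in> Ix \<Longrightarrow> T i \<subseteq> V" and disj: "disjoint_family_on T Ix"
    and cover: "V \<subseteq> W \<union> (\<Union>i\<in>Ix. T i)"
  shows "direct_sum M Ix (\<lambda>i. \<phi> ` mspan (T i))"
  unfolding direct_sum_def
proof (intro conjI ballI)
  fix x assume "x \<in> carrier M"
  then obtain p where x: "x = \<phi> p" and p: "p \<in> mspan V" by (auto simp: carrier_eq)
  have TV: "q \<in> mspan V" if "q \<in> mspan (T i)" "i \<in> Ix" for q :: "('k, 'n) mpol" and i
    using sub that mspan_mono by blast
  define P where "P i = restr (T i) p" for i
  have P: "P i \<in> mspan (T i)" for i by (simp add: P_def restr_mspan)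
  define f where "f = (\<lambda>i\<in>Ix. \<phi> (P i))"
  define S where "S = {i\<in>Ix. f i \<noteq> \<zero>}"
  have uniq: "i = j" if "i \<in> Ix" "j \<in> Ix" "k \<in> T i" "k \<in> T j" for i j k
    using disj that by (auto simp: disjoint_family_on_def)
  have nz: "i \<in> S \<longleftrightarrow> (\<exists>k. k \<notin> W \<and> k \<in> T i \<and> Poly_Mapping.lookup p k \<noteq> 0)" if "i \<in> Ix" for i
  proof -
    have "f i = \<zero> \<longleftrightarrow> \<phi> (P i) = \<phi> 0" using that by (simp add: f_def zero_eq)
    also have "\<dots> \<longleftrightarrow> (\<forall>k. k \<notin> W \<longrightarrow> Poly_Mapping.lookup (P i) k = 0)"
      using TV[OF P that] by (simp add: eq_iff_lookup)
    finally show ?thesis using that by (auto simp: S_def P_def lookup_restr when_def)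
  qed
  \<comment> \<open>Each nonzero component uses up an exponent of \<open>p\<close>, and by
    disjointness an exponent lies in at most one \<open>T i\<close>. This bounds the nonzero
    components even when \<open>Ix\<close> is infinite.\<close>
  have "S \<subseteq> (\<Union>k\<in>Poly_Mapping.keys p. {i\<in>Ix. k \<in> T i})"
    using nz by (fastforce simp: S_def in_keys_iff)
  moreover have "finite {i\<in>Ix. k \<in> T i}" for k
  proof (cases "\<exists>i. i \<in> Ix \<and> k \<in> T i")
    case True
    then obtain i where "i \<in> Ix" "k \<in> T i" by blast
    then have "{i\<in>Ix. k \<in> T i} \<subseteq> {i}" using uniq by blast
    then show ?thesis by (rule finite_subset) simp
  next
    case False
    then have "{i\<in>Ix. k \<in> T i} = {}" by blast
    then show ?thesis by (simp only: finite.emptyI)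
  qed
  ultimately have fin: "finite S"
    by (meson finite_UN_I finite_keys finite_subset)
  have sum_lookup: "Poly_Mapping.lookup (sum Q S') k = (if i \<in> S' then Poly_Mapping.lookup (Q i) k else 0)"
    if out: "finite S'" "S' \<subseteq> Ix" "\<And>j. j \<in> S' \<Longrightarrow> Q j \<in> mspan (T j)" "i \<in> Ix" "k \<in> T i"
    for Q :: "_ \<Rightarrow> ('k, 'n) mpol" and S' i k
  proof -
    have "Poly_Mapping.lookup (Q j) k = 0" if j: "j \<in> S'" "j \<noteq> i" for j
      using uniq[of i j k] j out mspan_lookup by blast
    then have "Poly_Mapping.lookup (sum Q S') k = (\<Sum>j\<in>S'. if i = j then Poly_Mapping.lookup (Q i) k else 0)"
      by (auto simp: lookup_sum intro!: sum.cong)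
    then show ?thesis using \<open>finite S'\<close> by simp
  qed
  have sumV: "sum Q S' \<in> mspan V" if "S' \<subseteq> Ix" "\<And>j. j \<in> S' \<Longrightarrow> Q j \<in> mspan (T j)"
    for Q :: "_ \<Rightarrow> ('k, 'n) mpol" and S'
    using that TV by (intro mspan_sum) blast
  have S_Ix: "S \<subseteq> Ix" by (auto simp: S_def)
  show "\<exists>!f. f \<in> (\<Pi>\<^sub>E i\<in>Ix. \<phi> ` mspan (T i)) \<and> finite {i\<in>Ix. f i \<noteq> \<zero>} \<and>
      x = (\<Oplus>i\<in>{i\<in>Ix. f i \<noteq> \<zero>}. f i)"
  proof (rule ex1I[of _ f], intro conjI)
    show "f \<in> (\<Pi>\<^sub>E i\<in>Ix. \<phi> ` mspan (T i))" using P by (auto simp: f_def)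
    show "finite {i\<in>Ix. f i \<noteq> \<zero>}" using fin by (simp add: S_def)
    interpret abelian_group M by (rule abelian_group)
    have "(\<Oplus>i\<in>S. f i) = (\<Oplus>i\<in>S. \<phi> (P i))"
      using S_Ix TV[OF P] by (intro finsum_cong') (auto simp: f_def)
    also have "\<dots> = \<phi> (sum P S)"
      using S_Ix TV[OF P] by (intro finsum_eq) auto
    also have "\<dots> = \<phi> p"
    proof -
      have "Poly_Mapping.lookup (sum P S) k = Poly_Mapping.lookup p k" if k: "k \<notin> W" for k
      proof (cases "k \<in> V")
        case True
        then obtain i where i: "i \<in> Ix" "k \<in> T i" using cover k by blast
        then have "Poly_Mapping.lookup (sum P S) k = (if i \<in> S then Poly_Mapping.lookup (P i) k else 0)"
          using fin S_Ix P by (intro sum_lookup) auto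
        then show ?thesis using nz[OF i(1)] i k by (auto simp: P_def lookup_restr)
      next
        case False
        then show ?thesis using sumV[OF S_Ix P] p by (simp add: mspan_lookup)
      qed
      then show ?thesis using sumV[OF S_Ix P] p by (simp add: eq_iff_lookup)
    qed
    finally show "x = (\<Oplus>i\<in>{i\<in>Ix. f i \<noteq> \<zero>}. f i)" by (simp add: x S_def)
  next
    interpret abelian_group M by (rule abelian_group)
    fix f' assume f': "f' \<in> (\<Pi>\<^sub>E i\<in>Ix. \<phi> ` mspan (T i)) \<and> finite {i\<in>Ix. f' i \<noteq> \<zero>} \<and>
      x = (\<Oplus>i\<in>{i\<in>Ix. f' i \<noteq> \<zero>}. f' i)"
    define S' where "S' = {i\<in>Ix. f' i \<noteq> \<zero>}"
    have S': "finite S'" "S' \<subseteq> Ix" "x = (\<Oplus>i\<in>S'. f' i)" using f' by (auto simp: S'_def)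
    have "\<forall>i\<in>Ix. \<exists>q. q \<in> mspan (T i) \<and> f' i = \<phi> q" using f' by (fastforce simp: PiE_iff)
    then obtain Q where Q: "\<And>i. i \<in> Ix \<Longrightarrow> Q i \<in> mspan (T i)" "\<And>i. i \<in> Ix \<Longrightarrow> f' i = \<phi> (Q i)"
      by metis
    have QV: "Q i \<in> mspan V" if "i \<in> Ix" for i using TV[OF Q(1)] that by blast
    have QS: "Q i \<in> mspan (T i)" if "i \<in> S'" for i using Q S' that by auto
    have "x = (\<Oplus>i\<in>S'. \<phi> (Q i))"
      unfolding S'(3) using S'(2) Q(2) QV by (intro finsum_cong') (auto simp: subset_iff)
    also have "\<dots> = \<phi> (sum Q S')"
      using S'(2) QV by (intro finsum_eq) auto
    finally have pQ: "Poly_Mapping.lookup p k = Poly_Mapping.lookup (sum Q S') k" if "k \<notin> W" for k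
      using x p sumV[OF S'(2) QS] that by (simp add: eq_iff_lookup)
    show "f' = f"
    proof (rule PiE_ext)
      show "f' \<in> (\<Pi>\<^sub>E i\<in>Ix. \<phi> ` mspan (T i))" using f' by blast
      show "f \<in> (\<Pi>\<^sub>E i\<in>Ix. \<phi> ` mspan (T i))" using P by (auto simp: f_def)
      fix i assume i: "i \<in> Ix"
      have "Poly_Mapping.lookup (Q i) k = Poly_Mapping.lookup (P i) k" if k: "k \<notin> W" for k
      proof (cases "k \<in> T i")
        case True
        \<comment> \<open>A component that vanishes in \<open>M\<close> may have a nonzero
          representative \<open>Q i\<close>, but all terms of it then lie in
          \<open>W\<close>.\<close>
        have "Poly_Mapping.lookup (Q i) k = 0" if "i \<notin> S'"
        proof -
          have "\<phi> (Q i) = \<phi> 0" using that i Q(2)[OF i] by (simp add: S'_def zero_eq)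
          then show ?thesis using TV[OF Q(1)[OF i] i] k by (simp add: eq_iff_lookup)
        qed
        then show ?thesis
          using pQ[OF k] sum_lookup[OF S'(1,2) QS i True] True by (simp add: P_def lookup_restr split: if_splits)
      next
        case False
        then show ?thesis using mspan_lookup[OF Q(1)[OF i]] mspan_lookup[OF P] by simp
      qed
      then show "f' i = f i"
        using TV[OF Q(1)[OF i] i] TV[OF P i] i Q(2)[OF i] by (simp add: eq_iff_lookup f_def)
    qed
  qed
qed (use sub in \<open>auto intro: K_subspace_image\<close>)

lemma graded_module: "graded_module M"
  unfolding graded_module_def
proof (intro conjI allI ballI)
  show "module pol_ring M" by (rule module)
  have h: "hcomp M = (\<lambda>a. \<phi> ` mspan (V \<inter> {b. \<forall>j. int (b $ j) = a $ j}))"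
    by (rule ext) (simp add: hcomp_eq graded_pol_eq mspan_Int)
  show "direct_sum M UNIV (hcomp M)"
    unfolding h
  proof (rule direct_sum_image)
    show "disjoint_family (\<lambda>a. V \<inter> {b. \<forall>j. int (b $ j) = a $ j})"
      by (auto simp: disjoint_family_on_def vec_eq_iff)
    have "b \<in> {b'. \<forall>j. int (b' $ j) = (\<chi> j. int (b $ j)) $ j}" for b :: "nat ^ 'n" by simp
    then show "V \<subseteq> W \<union> (\<Union>a. V \<inter> {b. \<forall>j. int (b $ j) = a $ j})" by blast
  qed auto
  fix a b x and p :: "('k, 'n) mpol" assume p: "p \<in> graded_pol a" and "x \<in> hcomp M b"
  then obtain q where q: "x = \<phi> q" "q \<in> mspan V" "q \<in> graded_pol b" by (auto simp: hcomp_eq)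
  have "p * q \<in> graded_pol (a + b)"
    using p q(3) keys_mult[of p q] by (fastforce simp: graded_pol_def)
  then show "p \<odot> x \<in> hcomp M (a + b)"
    using q up_V by (auto simp: hcomp_eq mspan_mult_up simp flip: smult_eq)
qed

end

text \<open>Congruence rule for the simplifier: the summands may be rewritten under the assumption
  that the index belongs to the index set.\<close>

lemma direct_sum_cong:
  assumes "Ix = Ix'" "\<And>i. i \<in> Ix' \<Longrightarrow> L i = L' i"
  shows "direct_sum M Ix L \<longleftrightarrow> direct_sum M Ix' L'"
proof -
  have "(\<Pi>\<^sub>E i\<in>Ix. L i) = (\<Pi>\<^sub>E i\<in>Ix'. L' i)" and "(\<forall>i\<in>Ix. K_subspace M (L i)) \<longleftrightarrow> (\<forall>i\<in>Ix'. K_subspace M (L' i))"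
    using assms by (auto intro: PiE_cong)
  then show ?thesis unfolding direct_sum_def by (simp only: assms(1))
qed

section \<open>Submodules, quotients and Stanley spaces in terms of exponents\<close>

context monomial_presentation
begin

lemma mspan_V: "T \<subseteq> V \<Longrightarrow> (p :: ('k, 'n) mpol) \<in> mspan T \<Longrightarrow> p \<in> mspan V"
  using mspan_mono by blast

lemma mspan_W: "W \<subseteq> T \<Longrightarrow> (p :: ('k, 'n) mpol) \<in> mspan W \<Longrightarrow> p \<in> mspan T"
  using mspan_mono by blast

lemma sub_presentation:
  assumes "W \<subseteq> U" "U \<subseteq> V" "up_closed U"
  shows "monomial_presentation (sub_gmod M (\<phi> ` mspan U)) U W \<phi>"
proof
  fix a
  show "hcomp (sub_gmod M (\<phi> ` mspan U)) a = \<phi> ` (mspan U \<inter> graded_pol a)"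
  proof
    show "hcomp (sub_gmod M (\<phi> ` mspan U)) a \<subseteq> \<phi> ` (mspan U \<inter> graded_pol a)"
    proof
      fix x assume "x \<in> hcomp (sub_gmod M (\<phi> ` mspan U)) a"
      then have "x \<in> \<phi> ` mspan U" "x \<in> \<phi> ` (mspan V \<inter> graded_pol a)"
        by (auto simp: sub_gmod_def hcomp_eq)
      then obtain p q where pq: "x = \<phi> p" "x = \<phi> q" "p \<in> mspan U" "q \<in> mspan V" "q \<in> graded_pol a"
        by blast
      then have "p - q \<in> mspan W"
        using assms mspan_V[OF assms(2)] by (simp flip: eq_iff)
      \<comment> \<open>The difference is \<open>q\<close>: the homogeneous representative, known
        only to lie in \<open>mspan V\<close>, lies in \<open>mspan U\<close> because it differs
        from \<open>p\<close> by an element of \<open>mspan W\<close>.\<close>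
      then have "p - (p - q) \<in> mspan U"
        by (rule mspan_diff[OF pq(3) mspan_W[OF assms(1)]])
      then show "x \<in> \<phi> ` (mspan U \<inter> graded_pol a)" unfolding pq(2) using pq(5) by simp
    qed
  qed (use mspan_V[OF assms(2)] in \<open>auto simp: sub_gmod_def hcomp_eq\<close>)
qed (use assms up_W mspan_V[OF assms(2)] in \<open>auto simp: sub_gmod_def add_eq zero_eq smult_eq eq_iff\<close>)

text \<open>Pulls cosets in \<open>M\<close> back to S, where computing with them becomes computing
  with polynomials modulo \<open>mspan U\<close>.\<close>

lemma a_rcoset_image:
  assumes "U \<subseteq> V" "p \<in> mspan V"
  shows "\<phi> ` mspan U +> \<phi> p = \<phi> ` {q \<in> mspan V. q - p \<in> mspan U}"
proof
  show "\<phi> ` mspan U +> \<phi> p \<subseteq> \<phi> ` {q \<in> mspan V. q - p \<in> mspan U}"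
  proof
    fix x assume "x \<in> \<phi> ` mspan U +> \<phi> p"
    then obtain u where u: "u \<in> mspan U" "x = \<phi> u \<oplus> \<phi> p" by (auto simp: a_r_coset_def')
    then have "x = \<phi> (u + p)" "u + p \<in> mspan V"
      using assms mspan_V[OF assms(1)] by (auto simp: add_eq intro: mspan_add)
    then show "x \<in> \<phi> ` {q \<in> mspan V. q - p \<in> mspan U}" using u by auto
  qed
  show "\<phi> ` {q \<in> mspan V. q - p \<in> mspan U} \<subseteq> \<phi> ` mspan U +> \<phi> p"
  proof
    fix x assume "x \<in> \<phi> ` {q \<in> mspan V. q - p \<in> mspan U}"
    then obtain q where q: "q \<in> mspan V" "q - p \<in> mspan U" "x = \<phi> q" by auto
    then have "x = \<phi> (q - p) \<oplus> \<phi> p"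
      using assms mspan_V[OF assms(1)] by (simp flip: add_eq)
    then show "x \<in> \<phi> ` mspan U +> \<phi> p" using q by (auto simp: a_r_coset_def')
  qed
qed

lemma a_rcoset_eq_iff:
  assumes "W \<subseteq> U" "U \<subseteq> V" "p \<in> mspan V" "q \<in> mspan V"
  shows "\<phi> ` mspan U +> \<phi> p = \<phi> ` mspan U +> \<phi> q \<longleftrightarrow> p - q \<in> mspan U"
proof
  assume "\<phi> ` mspan U +> \<phi> p = \<phi> ` mspan U +> \<phi> q"
  moreover have "\<phi> p \<in> \<phi> ` mspan U +> \<phi> p"
    using assms by (auto simp: a_rcoset_image)
  ultimately obtain q' where q': "q' \<in> mspan V" "q' - q \<in> mspan U" "\<phi> p = \<phi> q'"
    using assms by (auto simp: a_rcoset_image)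
  then have "p - q' \<in> mspan U" using assms mspan_W[OF assms(1)] by (auto simp: eq_iff)
  then show "p - q \<in> mspan U" using mspan_add[OF _ q'(2), of "p - q'"] by simp
next
  assume pq: "p - q \<in> mspan U"
  have "s - p \<in> mspan U \<longleftrightarrow> s - q \<in> mspan U" for s
    using mspan_add[OF _ pq, of "s - p"] mspan_diff[OF _ pq, of "s - q"] by auto
  then show "\<phi> ` mspan U +> \<phi> p = \<phi> ` mspan U +> \<phi> q"
    using assms by (simp add: a_rcoset_image)
qed

text \<open>The third isomorphism theorem: dividing span V / span W by span U / span W leaves span V
  / span U. This is what keeps cosets of sets of cosets out of all later arguments.\<close>

lemma quot_presentation:
  assumes U: "W \<subseteq> U" "U \<subseteq> V" "up_closed U"
  shows "monomial_presentation (quot_gmod M (\<phi> ` mspan U)) V U (\<lambda>p. \<phi> ` mspan U +> \<phi> p)"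
proof
  show "carrier (quot_gmod M (\<phi> ` mspan U)) = (\<lambda>p. \<phi> ` mspan U +> \<phi> p) ` mspan V"
    by (auto simp: quot_gmod_def A_RCOSETS_def' carrier_eq)
  show "\<phi> ` mspan U +> \<phi> 0 = \<zero>\<^bsub>quot_gmod M (\<phi> ` mspan U)\<^esub>"
    using U mspan_V[OF U(2)] by (auto simp: quot_gmod_def a_rcoset_image)
  show "hcomp (quot_gmod M (\<phi> ` mspan U)) a = (\<lambda>p. \<phi> ` mspan U +> \<phi> p) ` (mspan V \<inter> graded_pol a)" for a
    by (simp add: quot_gmod_def hcomp_eq image_image)
next
  fix p q :: "('k, 'n) mpol" assume pq: "p \<in> mspan V" "q \<in> mspan V"
  show "\<phi> ` mspan U +> \<phi> p = \<phi> ` mspan U +> \<phi> q \<longleftrightarrow> p - q \<in> mspan U"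
    using U pq by (simp add: a_rcoset_eq_iff)
  have "\<phi> ` mspan U +> \<phi> (p + q) = (\<phi> ` mspan U +> \<phi> p) <+> (\<phi> ` mspan U +> \<phi> q)" (is "?L = ?R")
  proof
    show "?L \<subseteq> ?R"
    proof
      fix x assume "x \<in> ?L"
      then obtain s where s: "x = \<phi> s" "s \<in> mspan V" "s - (p + q) \<in> mspan U"
        using U pq by (auto simp: a_rcoset_image mspan_add)
      have "x = \<phi> (s - q) \<oplus> \<phi> q" using s pq by (simp add: mspan_diff flip: add_eq)
      moreover have "\<phi> (s - q) \<in> \<phi> ` mspan U +> \<phi> p"
        using s pq U by (auto simp: a_rcoset_image mspan_diff algebra_simps)
      moreover have "\<phi> q \<in> \<phi> ` mspan U +> \<phi> q"
        using pq U by (auto simp: a_rcoset_image)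
      ultimately show "x \<in> ?R" by (auto simp: set_add_def')
    qed
    show "?R \<subseteq> ?L"
    proof
      fix x assume "x \<in> ?R"
      then obtain s t where st: "x = \<phi> s \<oplus> \<phi> t" "s \<in> mspan V" "s - p \<in> mspan U"
          "t \<in> mspan V" "t - q \<in> mspan U"
        using U pq by (auto simp: a_rcoset_image set_add_def')
      have "(s + t) - (p + q) \<in> mspan U"
        using mspan_add[OF st(3,5)] by (simp add: algebra_simps)
      then show "x \<in> ?L"
        using st U pq by (auto simp: a_rcoset_image mspan_add simp flip: add_eq)
    qed
  qed
  then show "\<phi> ` mspan U +> \<phi> (p + q) =
      (\<phi> ` mspan U +> \<phi> p) \<oplus>\<^bsub>quot_gmod M (\<phi> ` mspan U)\<^esub> (\<phi> ` mspan U +> \<phi> q)"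
    by (simp add: quot_gmod_def)
next
  fix s p :: "('k, 'n) mpol" assume p: "p \<in> mspan V"
  \<comment> \<open>Scalar multiplication in the quotient is a union over all representatives of a
    coset. By this step the union is over a constant family, and the coset is nonempty.\<close>
  have *: "\<phi> ` mspan U +> (s \<odot> x) = \<phi> ` mspan U +> \<phi> (s * p)" if x: "x \<in> \<phi> ` mspan U +> \<phi> p" for x
  proof -
    obtain q where q: "x = \<phi> q" "q \<in> mspan V" "q - p \<in> mspan U"
      using x p U by (auto simp: a_rcoset_image)
    have "s * q - s * p \<in> mspan U"
      using mspan_mult_up[OF U(3) q(3), of s] by (simp add: algebra_simps)
    then show ?thesis
      using U p q up_V by (simp add: a_rcoset_eq_iff mspan_mult_up flip: smult_eq)
  qed
  have "(\<Union>x\<in>\<phi> ` mspan U +> \<phi> p. \<phi> ` mspan U +> (s \<odot> x))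
      = (\<Union>x\<in>\<phi> ` mspan U +> \<phi> p. \<phi> ` mspan U +> \<phi> (s * p))"
    by (intro SUP_cong refl *)
  moreover have "\<phi> p \<in> \<phi> ` mspan U +> \<phi> p" using p U by (auto simp: a_rcoset_image)
  ultimately have "(\<Union>x\<in>\<phi> ` mspan U +> \<phi> p. \<phi> ` mspan U +> (s \<odot> x)) = \<phi> ` mspan U +> \<phi> (s * p)"
    by (metis UN_constant empty_iff)
  then show "\<phi> ` mspan U +> \<phi> (s * p) =
      s \<odot>\<^bsub>quot_gmod M (\<phi> ` mspan U)\<^esub> (\<phi> ` mspan U +> \<phi> p)"
    by (simp add: quot_gmod_def)
qed (use assms up_V in auto)

lemma stanley_set_eq:
  assumes "(+) e ` mon_supported Z \<subseteq> V"
  shows "stanley_set M (\<phi> (mon e)) Z = \<phi> ` mspan ((+) e ` mon_supported Z)"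
    (is "_ = \<phi> ` mspan ?T")
proof
  note zero_mon_supported[of Z]
  then have e: "e \<in> V" using assms by force
  have gen: "mon a \<odot> \<phi> (mon e) = \<phi> (mon (e + a))" for a
    using e by (simp add: mon_mult_mon add.commute flip: smult_eq)
  show "stanley_set M (\<phi> (mon e)) Z \<subseteq> \<phi> ` mspan ?T"
    unfolding stanley_set_def K_span_def using K_subspace_image[OF assms]
    by (intro Inter_lower) (auto simp: gen)
  show "\<phi> ` mspan ?T \<subseteq> stanley_set M (\<phi> (mon e)) Z"
    unfolding stanley_set_def K_span_def
  proof (intro Inter_greatest)
    fix L assume "L \<in> {L. K_subspace M L \<and> {mon a \<odot> \<phi> (mon e) |a. a \<in> mon_supported Z} \<subseteq> L}"
    then have L: "subgroup L (add_monoid M)" "\<And>k v. v \<in> L \<Longrightarrow> const_pol k \<odot> v \<in> L"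
      "\<And>b. b \<in> ?T \<Longrightarrow> \<phi> (mon b) \<in> L"
      by (auto simp: K_subspace_def gen)
    have single: "\<phi> (Poly_Mapping.single b k) \<in> L" if "b \<in> ?T" for b k
      using L(2)[OF L(3)[OF that], of k] that assms
      by (auto simp: const_pol_mult_mon simp flip: smult_eq)
    have "\<phi> (sum P S) \<in> L" if "\<And>b. b \<in> S \<Longrightarrow> P b \<in> mspan V \<and> \<phi> (P b) \<in> L"
      for S and P :: "nat ^ 'n \<Rightarrow> ('k, 'n) mpol"
      using that
      by (induction S rule: infinite_finite_induct)
        (use subgroup.one_closed[OF L(1)] subgroup.m_closed[OF L(1)] in
          \<open>auto simp: zero_eq add_eq mspan_sum\<close>)
    note sum = this
    show "\<phi> ` mspan ?T \<subseteq> L"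
    proof (rule image_subsetI)
      fix p :: "('k, 'n) mpol" assume "p \<in> mspan ?T"
      then have keys: "b \<in> ?T" "b \<in> V" if "b \<in> Poly_Mapping.keys p" for b
        using that assms by (auto simp only: mspan_def)
      have "\<phi> (\<Sum>a\<in>Poly_Mapping.keys p. Poly_Mapping.single a (Poly_Mapping.lookup p a)) \<in> L"
        by (intro sum conjI single keys) (simp_all add: mspan_def keys(2))
      then show "\<phi> p \<in> L" by (simp flip: poly_mapping_sum_single)
    qed
  qed
qed

text \<open>Freeness comes from avoiding \<open>W\<close>: no coefficient of x^e s with s in K[Z] is
  lost in \<open>M\<close>, so s can be recovered from its product with the generator, and the
  generator alone is a basis.\<close>

lemma stanley_space_mon:
  assumes "(+) e ` mon_supported Z \<subseteq> V - W"
  shows "stanley_space M (\<phi> (mon e)) Z"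
proof -
  let ?T = "(+) e ` mon_supported Z" and ?u = "\<phi> (mon e)"
  interpret abelian_group M by (rule abelian_group)
  have TV: "?T \<subseteq> V" using assms by blast
  note zero_mon_supported[of Z]
  then have e: "e \<in> V" "e \<notin> W" using assms by force+
  have u: "s \<odot> ?u = \<phi> (mon e * s)" "mon e * s \<in> mspan V" for s
    using e up_V by (simp_all add: mult.commute mspan_mult_up flip: smult_eq)
  have sub: "mon e * s \<in> mspan ?T \<longleftrightarrow> s \<in> sub_pol Z" for s
    by (simp add: mspan_def sub_pol_def keys_mon_mult inj_image_subset_iff)
  have inj: "s = t" if "s \<in> sub_pol Z" "t \<in> sub_pol Z" "s \<odot> ?u = t \<odot> ?u" for s t
  proof (rule poly_mapping_eqI)
    fix k
    show "Poly_Mapping.lookup s k = Poly_Mapping.lookup t k"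
    proof (cases "k \<in> mon_supported Z")
      case True
      then have "e + k \<notin> W" using assms by blast
      then have "Poly_Mapping.lookup (mon e * s) (e + k) = Poly_Mapping.lookup (mon e * t) (e + k)"
        using that u by (simp add: eq_iff_lookup)
      then show ?thesis by (simp add: lookup_mon_mult)
    next
      case False
      then show ?thesis
        using mspan_lookup[OF that(1)[unfolded sub_pol_eq]] mspan_lookup[OF that(2)[unfolded sub_pol_eq]]
        by simp
    qed
  qed
  have nz: "?u \<noteq> \<zero>"
  proof
    assume "?u = \<zero>"
    then have "\<phi> (mon e) = \<phi> 0" by (simp add: zero_eq)
    then show False using e by (simp add: eq_iff)
  qed
  have free: "\<exists>!f. f \<in> {?u} \<rightarrow>\<^sub>E sub_pol Z \<and> finite {b\<in>{?u}. f b \<noteq> 0} \<and>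
        v = (\<Oplus>b\<in>{b\<in>{?u}. f b \<noteq> 0}. f b \<odot> b)" if v: "v \<in> \<phi> ` mspan ?T" for v
  proof -
    \<comment> \<open>The formula also holds when the coefficient is 0: the sum is then empty, and
      the right-hand side vanishes as well.\<close>
    have sum: "(\<Oplus>b\<in>{b\<in>{?u}. f b \<noteq> 0}. f b \<odot> b) = f ?u \<odot> ?u" for f :: "'b \<Rightarrow> ('k, 'n) mpol"
    proof (cases "f ?u = 0")
      case True
      then have *: "{b\<in>{?u}. f b \<noteq> 0} = {}" by auto
      show ?thesis unfolding * using True by (simp add: u zero_eq)
    next
      case False
      then have *: "{b\<in>{?u}. f b \<noteq> 0} = {?u}" by auto
      show ?thesis unfolding * using u by simp
    qed
    obtain q where q: "q \<in> mspan ?T" "v = \<phi> q" using v by blast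
    obtain s where s: "q = mon e * s"
      using mspan_shift[OF q(1), of e] by (auto simp: vec_le_iff_add)
    then have s': "s \<in> sub_pol Z" "v = s \<odot> ?u" using q sub u by auto
    have fin: "finite {b\<in>{?u}. f b \<noteq> 0}" for f :: "'b \<Rightarrow> ('k, 'n) mpol"
      by (rule finite_subset[of _ "{?u}"]) auto
    show ?thesis
      unfolding sum using fin
    proof (intro ex1I[of _ "\<lambda>b\<in>{?u}. s"] conjI)
      fix f assume f: "f \<in> {?u} \<rightarrow>\<^sub>E sub_pol Z \<and> finite {b\<in>{?u}. f b \<noteq> 0} \<and> v = f ?u \<odot> ?u"
      then have "f ?u = s" using s' inj by (auto simp: PiE_iff)
      then show "f = (\<lambda>b\<in>{?u}. s)" using f by (auto simp: PiE_iff extensional_def)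
    qed (use s' in auto)
  qed
  have hom: "?u \<in> hcomp M (\<chi> j. int (e $ j))"
    unfolding hcomp_eq using e by (intro imageI IntI mon_graded) simp
  have closed: "\<forall>p\<in>sub_pol Z. \<forall>v\<in>\<phi> ` mspan ?T. p \<odot> v \<in> \<phi> ` mspan ?T"
  proof (intro ballI)
    fix v and p :: "('k, 'n) mpol" assume p: "p \<in> sub_pol Z" and "v \<in> \<phi> ` mspan ?T"
    then obtain q where q: "v = \<phi> q" "q \<in> mspan ?T" by auto
    obtain s where s: "q = mon e * s"
      using mspan_shift[OF q(2), of e] by (auto simp: vec_le_iff_add)
    then have "mon e * (p * s) \<in> mspan ?T"
      using p q(2) unfolding s sub by (intro sub_pol_mult)
    then have "p * q \<in> mspan ?T" by (simp add: s mult.left_commute)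
    moreover have "p \<odot> v = \<phi> (p * q)"
      by (simp add: q smult_eq mspan_V[OF TV])
    ultimately show "p \<odot> v \<in> \<phi> ` mspan ?T" by blast
  qed
  have "free_over M (sub_pol Z) (\<phi> ` mspan ?T)"
    unfolding free_over_def
  proof (intro conjI subgroup_image[OF TV] closed exI[of _ "{?u}"])
    have "e + 0 \<in> ?T" using zero_mon_supported by (rule imageI)
    then show "{?u} \<subseteq> \<phi> ` mspan ?T" by simp
  qed (rule ballI, rule free)
  then show ?thesis
    unfolding stanley_space_def stanley_set_eq[OF TV] by (intro conjI nz exI[of _ "\<chi> j. int (e $ j)"] hom)
qed

lemma stanley_decomposition_mon:
  assumes "finite Ix" "\<And>i. i \<in> Ix \<Longrightarrow> (+) (e i) ` mon_supported (Z i) \<subseteq> V - W"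
    and "disjoint_family_on (\<lambda>i. (+) (e i) ` mon_supported (Z i)) Ix"
    and "V \<subseteq> W \<union> (\<Union>i\<in>Ix. (+) (e i) ` mon_supported (Z i))"
  shows "stanley_decomposition M Ix (\<lambda>i. \<phi> (mon (e i))) Z"
proof -
  have "direct_sum M Ix (\<lambda>i. \<phi> ` mspan ((+) (e i) ` mon_supported (Z i)))"
    using assms by (intro direct_sum_image) blast+
  moreover have "stanley_set M (\<phi> (mon (e i))) (Z i) = \<phi> ` mspan ((+) (e i) ` mon_supported (Z i))"
    if "i \<in> Ix" for i
    using assms(2)[OF that] by (intro stanley_set_eq) blast
  ultimately have "direct_sum M Ix (\<lambda>i. stanley_set M (\<phi> (mon (e i))) (Z i))"
    by (simp cong: direct_sum_cong)
  then show ?thesis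
    unfolding stanley_decomposition_def using assms(1,2) stanley_space_mon by blast
qed

lemma graded_submodule_image:
  assumes "W \<subseteq> U" "U \<subseteq> V" "up_closed U"
  shows "graded_submodule M (\<phi> ` mspan U)"
proof -
  have "submodule (\<phi> ` mspan U) pol_ring M"
  proof (intro submodule.intro subgroup_image assms submodule_axioms.intro)
    fix s x assume "x \<in> \<phi> ` mspan U"
    then obtain p where p: "x = \<phi> p" "p \<in> mspan U" by auto
    then have "s \<odot> x = \<phi> (s * p)" by (simp add: smult_eq mspan_V[OF assms(2)])
    then show "s \<odot> x \<in> \<phi> ` mspan U"
      using mspan_mult_up[OF assms(3) p(2)] by blast
  qed
  then show ?thesis
    using monomial_presentation.graded_module[OF sub_presentation[OF assms]]
    by (simp add: graded_submodule_def)
qed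

text \<open>Dropping the terms of \<open>p\<close> in \<open>W\<close> changes neither its class nor
  its homogeneity, and every remaining term is divisible by x^e. This yields both that
  \<open>M\<close> is cyclic and how degrees shift.\<close>

lemma shift_rep:
  assumes p: "p \<in> mspan V" and e: "e \<in> V" "\<And>f. f \<in> V - W \<Longrightarrow> e \<le> f"
  obtains q where "\<phi> p = \<phi> (mon e * q)"
    and "\<And>a. p \<in> graded_pol a \<Longrightarrow> q \<in> graded_pol (a - (\<chi> j. int (e $ j)))"
proof -
  have "restr (- W) p \<in> mspan (V - W)"
    using restr_mspan_Int[OF p, of "- W"] by (simp add: Diff_eq Int_commute)
  then obtain q where q: "restr (- W) p = mon e * q"
    using mspan_shift[of _ "V - W" e] e(2) by blast
  have "restr (- W) p \<in> mspan V"
    using e(1) up_V by (auto simp: q intro: mspan_mult_up_right)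
  then have "\<phi> p = \<phi> (restr (- W) p)"
    using p by (simp add: eq_iff_lookup lookup_restr)
  then have "\<phi> p = \<phi> (mon e * q)" by (simp only: q)
  moreover have "q \<in> graded_pol (a - (\<chi> j. int (e $ j)))" if "p \<in> graded_pol a" for a
  proof -
    have "restr (- W) p \<in> mspan (- W \<inter> {b. \<forall>j. int (b $ j) = a $ j})"
      using that by (intro restr_mspan_Int) (simp add: graded_pol_eq)
    then have "restr (- W) p \<in> graded_pol a"
      by (simp add: graded_pol_eq mspan_def)
    then show ?thesis
      unfolding q by (auto simp: graded_pol_def keys_mon_mult eq_diff_eq add.commute)
  qed
  ultimately show thesis by (rule that)
qed

lemma carrier_cyclic:
  assumes "e \<in> V" "\<And>f. f \<in> V - W \<Longrightarrow> e \<le> f"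
  shows "carrier M = range (\<lambda>p. p \<odot> \<phi> (mon e))"
proof
  have smult: "p \<odot> \<phi> (mon e) = \<phi> (mon e * p)" "mon e * p \<in> mspan V" for p
    using assms(1) up_V by (simp_all add: mult.commute mspan_mult_up flip: smult_eq)
  show "carrier M \<subseteq> range (\<lambda>p. p \<odot> \<phi> (mon e))"
    unfolding carrier_eq smult using shift_rep[OF _ assms] by blast
  show "range (\<lambda>p. p \<odot> \<phi> (mon e)) \<subseteq> carrier M"
    unfolding smult using smult(2) by auto
qed

end

text \<open>Cosets depend only on the addition, which a submodule inherits; cosets formed inside a
  step of a filtration can thus be written in the ambient module.\<close>

lemma a_r_coset_sub_gmod: "N +>\<^bsub>sub_gmod M L\<^esub> x = N +>\<^bsub>M\<^esub> x"
  by (simp add: a_r_coset_def' sub_gmod_def)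

lemma pol_gmod_presentation: "monomial_presentation pol_gmod UNIV {} (\<lambda>p. p)"
  by unfold_locales (auto simp: up_closed_def pol_gmod_def)

text \<open>The isomorphism is inverse to multiplication by x^e from S / span W' to span V / span W.
  The hypothesis on \<open>e + f\<close> makes that multiplication well defined and injective; the
  hypothesis that V - W lies above \<open>e\<close> makes it surjective.\<close>

lemma gmod_iso_shift:
  fixes M :: "('k::field, 'n::finite, 'b) gmod" and N :: "('k, 'n, 'c) gmod"
  assumes M: "monomial_presentation M V W \<phi>" and N: "monomial_presentation N UNIV W' \<psi>"
    and e: "e \<in> V" "\<And>f. e + f \<in> W \<longleftrightarrow> f \<in> W'" "\<And>f. f \<in> V - W \<Longrightarrow> e \<le> f"
  shows "gmod_iso M (shift_gmod N (\<chi> j. int (e $ j)))"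
proof -
  interpret M: monomial_presentation M V W \<phi> by (rule M)
  interpret N: monomial_presentation N UNIV W' \<psi> by (rule N)
  have eV: "mon e * q \<in> mspan V" for q :: "('k, 'n) mpol"
    using e(1) M.up_V by (auto intro: mspan_mult_up_right)
  have eW: "mon e * q \<in> mspan W \<longleftrightarrow> q \<in> mspan W'" for q :: "('k, 'n) mpol"
    using e(2) by (simp add: mon_mult_mspan)
  have wd: "\<phi> (mon e * q) = \<phi> (mon e * q') \<longleftrightarrow> \<psi> q = \<psi> q'" for q q'
    using eV eW[of "q - q'"] by (simp add: M.eq_iff N.eq_iff right_diff_distrib)
  \<comment> \<open>Divides by x^e, with an arbitrary choice of the quotient. By \<open>wd\<close>
    the choice does not affect the class under \<open>\<psi>\<close>, and the converse direction of
    \<open>wd\<close> gives injectivity.\<close>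
  define f where "f x = \<psi> (SOME q. \<phi> (mon e * q) = x)" for x
  have f: "f (\<phi> (mon e * q)) = \<psi> q" for q
    unfolding f_def by (rule someI2[of _ q]) (simp_all add: wd)
  have car: "\<exists>q. x = \<phi> (mon e * q)" if "x \<in> carrier M" for x
    using that M.shift_rep[OF _ e(1,3)] unfolding M.carrier_eq by blast
  show ?thesis
    unfolding gmod_iso_def
  proof (intro exI[of _ f] conjI ballI allI)
    show "bij_betw f (carrier M) (carrier (shift_gmod N (\<chi> j. int (e $ j))))"
      unfolding bij_betw_def
    proof
      show "inj_on f (carrier M)"
        by (intro inj_onI) (metis car f wd)
      show "f ` carrier M = carrier (shift_gmod N (\<chi> j. int (e $ j)))"
      proof
        show "f ` carrier M \<subseteq> carrier (shift_gmod N (\<chi> j. int (e $ j)))"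
          using car f by (fastforce simp: shift_gmod_def N.carrier_eq)
        show "carrier (shift_gmod N (\<chi> j. int (e $ j))) \<subseteq> f ` carrier M"
          using eV by (auto simp: shift_gmod_def N.carrier_eq M.carrier_eq simp flip: f)
      qed
    qed
  next
    fix x y assume "x \<in> carrier M" "y \<in> carrier M"
    then obtain q s where "x = \<phi> (mon e * q)" "y = \<phi> (mon e * s)" using car by metis
    then show "f (x \<oplus>\<^bsub>M\<^esub> y) = f x \<oplus>\<^bsub>shift_gmod N (\<chi> j. int (e $ j))\<^esub> f y"
      using eV by (simp add: shift_gmod_def f N.add_eq flip: M.add_eq distrib_left)
  next
    fix p x assume "x \<in> carrier M"
    then obtain q where q: "x = \<phi> (mon e * q)" using car by metis
    have "p \<odot>\<^bsub>M\<^esub> x = \<phi> (mon e * (p * q))"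
      by (simp add: q mult.left_commute eV flip: M.smult_eq)
    then show "f (p \<odot>\<^bsub>M\<^esub> x) = p \<odot>\<^bsub>shift_gmod N (\<chi> j. int (e $ j))\<^esub> f x"
      by (simp add: shift_gmod_def f q N.smult_eq)
  next
    fix a
    show "f ` hcomp M a = hcomp (shift_gmod N (\<chi> j. int (e $ j))) a"
    proof
      show "f ` hcomp M a \<subseteq> hcomp (shift_gmod N (\<chi> j. int (e $ j))) a"
      proof
        fix y assume "y \<in> f ` hcomp M a"
        then obtain p where p: "y = f (\<phi> p)" "p \<in> mspan V" "p \<in> graded_pol a"
          by (auto simp: M.hcomp_eq)
        then obtain q where "\<phi> p = \<phi> (mon e * q)" "q \<in> graded_pol (a - (\<chi> j. int (e $ j)))"
          using M.shift_rep[OF _ e(1,3)] by metis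
        then show "y \<in> hcomp (shift_gmod N (\<chi> j. int (e $ j))) a"
          using p by (auto simp: shift_gmod_def N.hcomp_eq f)
      qed
      show "hcomp (shift_gmod N (\<chi> j. int (e $ j))) a \<subseteq> f ` hcomp M a"
      proof
        fix y assume "y \<in> hcomp (shift_gmod N (\<chi> j. int (e $ j))) a"
        then obtain q where q: "y = \<psi> q" "q \<in> graded_pol (a - (\<chi> j. int (e $ j)))"
          by (auto simp: shift_gmod_def N.hcomp_eq)
        have "mon e * q \<in> graded_pol a"
          using q(2) by (auto simp: graded_pol_def keys_mon_mult)
        then show "y \<in> f ` hcomp M a"
          using q eV by (auto simp: M.hcomp_eq simp flip: f)
      qed
    qed
  qed
qed

section \<open>Monomial primes and prime filtrations\<close>

text \<open>
  The library's domain instance needs linearly ordered exponents, so minimal exponents are compared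
  through an additive embedding of \<open>nat ^ 'n\<close> into the lexicographically ordered \<open>nat \<Rightarrow>\<^sub>0 nat\<close>.
\<close>
lemma mpol_no_zero_divisors:
  fixes p q :: "('k::field, 'n::finite) mpol"
  assumes "p \<noteq> 0" "q \<noteq> 0"
  shows "p * q \<noteq> 0"
proof -
  obtain idx :: "'n \<Rightarrow> nat" where idx: "inj idx"
    using finite_imp_inj_to_nat_seg[OF finite[of "UNIV :: 'n set"]] by blast
  define h :: "nat ^ 'n \<Rightarrow> (nat \<Rightarrow>\<^sub>0 nat)" where "h a = (\<Sum>j\<in>UNIV. Poly_Mapping.single (idx j) (a $ j))" for a
  have h_add: "h (a + b) = h a + h b" for a b
    by (simp add: h_def single_add sum.distrib)
  have "Poly_Mapping.lookup (h a) (idx j) = a $ j" for a j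
    using idx by (simp add: h_def lookup_sum lookup_single when_def inj_eq)
  then have h_inj: "a = b" if "h a = h b" for a b
    using that by (metis vec_eq_iff)
  have min_key: "\<exists>f\<in>Poly_Mapping.keys s. \<forall>b\<in>Poly_Mapping.keys s. b \<noteq> f \<longrightarrow> h f < h b"
    if "s \<noteq> 0" for s :: "('k, 'n) mpol"
  proof -
    have fin: "finite (h ` Poly_Mapping.keys s)" "h ` Poly_Mapping.keys s \<noteq> {}"
      using that by simp_all
    then obtain f where "f \<in> Poly_Mapping.keys s" "h f = Min (h ` Poly_Mapping.keys s)"
      using Min_in[OF fin] by force
    then show ?thesis
      using fin h_inj by (intro bexI[of _ f]) (auto simp: order.strict_iff_order)
  qed
  obtain f where f: "f \<in> Poly_Mapping.keys p" "\<And>b. b \<in> Poly_Mapping.keys p \<Longrightarrow> b \<noteq> f \<Longrightarrow> h f < h b"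
    using min_key[OF assms(1)] by blast
  obtain f' where f': "f' \<in> Poly_Mapping.keys q" "\<And>b. b \<in> Poly_Mapping.keys q \<Longrightarrow> b \<noteq> f' \<Longrightarrow> h f' < h b"
    using min_key[OF assms(2)] by blast
  \<comment> \<open>Split off the terms that are lowest with respect to \<open>h\<close>. Every
    product involving a remainder has exponents strictly above \<open>h f + h f'\<close>, so nothing
    cancels the product of the two lowest terms.\<close>
  define p1 where "p1 = p - Poly_Mapping.single f (Poly_Mapping.lookup p f)"
  define q1 where "q1 = q - Poly_Mapping.single f' (Poly_Mapping.lookup q f')"
  have p1: "a \<in> Poly_Mapping.keys p1 \<Longrightarrow> h f < h a" for a
    using f(2)[of a] by (cases "a = f") (auto simp: p1_def in_keys_iff lookup_minus lookup_single)
  have q1: "a \<in> Poly_Mapping.keys q1 \<Longrightarrow> h f' < h a" for a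
    using f'(2)[of a] by (cases "a = f'") (auto simp: q1_def in_keys_iff lookup_minus lookup_single)
  have q': "h f' \<le> h a" if "a \<in> Poly_Mapping.keys q" for a
    using f'(2)[OF that] by (cases "a = f'") auto
  have "p * q = Poly_Mapping.single (f + f') (Poly_Mapping.lookup p f * Poly_Mapping.lookup q f')
      + Poly_Mapping.single f (Poly_Mapping.lookup p f) * q1 + p1 * q"
    by (simp add: p1_def q1_def algebra_simps mult_single)
  moreover have "f + f' \<notin> Poly_Mapping.keys (Poly_Mapping.single f (Poly_Mapping.lookup p f) * q1)"
  proof
    assume "f + f' \<in> Poly_Mapping.keys (Poly_Mapping.single f (Poly_Mapping.lookup p f) * q1)"
    then obtain a where "f + f' = f + a" "a \<in> Poly_Mapping.keys q1"
      using keys_mult[of "Poly_Mapping.single f (Poly_Mapping.lookup p f)" q1]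
      by (auto split: if_splits)
    then show False using q1[of a] by simp
  qed
  moreover have "f + f' \<notin> Poly_Mapping.keys (p1 * q)"
  proof
    assume "f + f' \<in> Poly_Mapping.keys (p1 * q)"
    then obtain a b where ab: "f + f' = a + b" "a \<in> Poly_Mapping.keys p1" "b \<in> Poly_Mapping.keys q"
      using keys_mult[of p1 q] by blast
    then have "h f + h f' < h a + h b"
      using p1 q' by (intro add_less_le_mono)
    then show False using arg_cong[OF ab(1), of h] by (simp add: h_add)
  qed
  ultimately have "Poly_Mapping.lookup (p * q) (f + f') = Poly_Mapping.lookup p f * Poly_Mapping.lookup q f'"
    by (simp add: lookup_add in_keys_iff)
  then show ?thesis using f(1) f'(1) by (auto simp: in_keys_iff)
qed

lemma up_closed_compl_mon_supported: "up_closed (- mon_supported Z)"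
  by (auto simp: up_closed_def mon_supported_def)

text \<open>The exponents outside \<open>mon_supported Z\<close> are those divisible by a variable
  outside Z, so P is generated by these variables. Modulo P each polynomial may be replaced by its
  part in K[Z], which reduces primality to the absence of zero divisors.\<close>

lemma monomial_prime_variables:
  "monomial_prime (mspan (- mon_supported Z) :: ('k::field, 'n::finite) mpol set)"
  unfolding monomial_prime_def
proof
  let ?P = "mspan (- mon_supported Z) :: ('k, 'n) mpol set"
  have "axis j 1 \<le> f \<longleftrightarrow> f $ j \<noteq> 0" for j and f :: "nat ^ 'n"
  proof
    assume "axis j 1 \<le> f"
    then have "axis j 1 $ j \<le> f $ j" unfolding less_eq_vec_def by blast
    then show "f $ j \<noteq> 0" by (simp add: axis_def)
  qed (simp add: less_eq_vec_def axis_def)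
  then have "up_set {axis j 1 | j. j \<notin> Z} = - mon_supported Z"
    by (force simp: up_set_def mon_supported_def)
  then show "\<exists>A. ?P = gen_mon_ideal A"
    by (intro exI[of _ "{axis j 1 | j. j \<notin> Z}"]) (simp add: gen_mon_ideal_eq)
  have ideal: "ideal ?P pol_ring"
    by (rule ideal_mspan[OF up_closed_compl_mon_supported])
  show "primeideal ?P pol_ring"
  proof (intro primeideal.intro primeideal_axioms.intro ideal cring_pol_ring)
    have "mon 0 \<notin> ?P" by (simp add: mon_supported_def)
    then have "?P \<noteq> UNIV" by blast
    then show "carrier pol_ring \<noteq> ?P" by simp
    fix p q :: "('k, 'n) mpol" assume pq: "p \<otimes>\<^bsub>pol_ring\<^esub> q \<in> ?P"
    define p0 where "p0 = restr (mon_supported Z) p"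
    define q0 where "q0 = restr (mon_supported Z) q"
    have p: "p - p0 \<in> ?P" and q: "q - q0 \<in> ?P"
      by (simp_all add: p0_def q0_def mspan_iff lookup_minus lookup_restr)
    have "p0 * q0 = p * q - (p - p0) * q - p0 * (q - q0)"
      by (simp add: algebra_simps)
    moreover have "(p - p0) * q \<in> ?P"
      by (rule mspan_mult_up_right[OF up_closed_compl_mon_supported p])
    moreover have "p0 * (q - q0) \<in> ?P"
      by (rule mspan_mult_up[OF up_closed_compl_mon_supported q])
    ultimately have "p0 * q0 \<in> ?P"
      using pq by (simp add: mspan_diff)
    moreover have "p0 * q0 \<in> mspan (mon_supported Z)"
      using sub_pol_mult[of p0 Z q0] by (simp add: sub_pol_eq p0_def q0_def restr_mspan)
    \<comment> \<open>The product lies both in P and in K[Z], and these meet only in 0.\<close>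
    ultimately have "p0 * q0 \<in> mspan (- mon_supported Z \<inter> mon_supported Z)"
      by (simp only: mspan_Int[symmetric] IntI)
    then have "p0 = 0 \<or> q0 = 0"
      using mpol_no_zero_divisors by auto
    then show "p \<in> ?P \<or> q \<in> ?P" using p q by auto
  qed
qed

section \<open>Filtrations obtained by sorting the pieces\<close>

lemma finite_enumeration_by_key:
  fixes key :: "'a \<Rightarrow> 'b::linorder"
  assumes "finite Ix"
  obtains m \<sigma> where "bij_betw \<sigma> {1..m} Ix"
    and "\<And>k l. k \<in> {1..m} \<Longrightarrow> l \<in> {1..m} \<Longrightarrow> key (\<sigma> k) < key (\<sigma> l) \<Longrightarrow> k < (l::nat)"
proof -
  obtain ys where ys: "set ys = Ix" "distinct ys" using finite_distinct_list[OF assms] by blast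
  define xs where "xs = sort_key key ys"
  have xs: "set xs = Ix" "distinct xs" "sorted (map key xs)" using ys by (simp_all add: xs_def)
  \<comment> \<open>Pieces are numbered from 1, like the steps of the filtration, and list positions
    from 0.\<close>
  define \<sigma> where "\<sigma> k = xs ! (k - 1)" for k
  have "bij_betw (\<lambda>k. k - 1) {1..length xs} {..<length xs}"
    by (rule bij_betw_byWitness[of _ "Suc"]) auto
  then have "bij_betw ((\<lambda>k. xs ! k) \<circ> (\<lambda>k. k - 1)) {1..length xs} Ix"
    by (rule bij_betw_trans) (use bij_betw_nth[OF xs(2) refl refl] xs(1) in simp)
  then have 1: "bij_betw \<sigma> {1..length xs} Ix" by (simp add: \<sigma>_def[abs_def] comp_def)
  have 2: "k < l" if kl: "k \<in> {1..length xs}" "l \<in> {1..length xs}" "key (\<sigma> k) < key (\<sigma> l)" for k l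
  proof (rule ccontr)
    assume "\<not> k < l"
    then have "key (xs ! (l - 1)) \<le> key (xs ! (k - 1))"
      using sorted_nth_mono[OF xs(3), of "l - 1" "k - 1"] kl by auto
    then show False using kl(3) by (simp add: \<sigma>_def)
  qed
  show thesis by (rule that[OF 1 2])
qed

context monomial_presentation
begin

text \<open>A multiple of a monomial in \<open>T i\<close> stays in \<open>T i\<close>, falls into
  \<open>W\<close>, or reaches a piece of strictly smaller key, which sorting has placed earlier; so
  the initial unions are up-closed. Pieces of equal key never reach one another, and their mutual
  order may be arbitrary.\<close>

lemma induced_by_prime_filtration_mon:
  fixes e :: "'i \<Rightarrow> nat ^ 'n" and Z :: "'i \<Rightarrow> 'n set" and key :: "'i \<Rightarrow> int"
  defines "T \<equiv> \<lambda>i. (+) (e i) ` mon_supported (Z i)"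
  assumes fin: "finite Ix" and sub: "\<And>i. i \<in> Ix \<Longrightarrow> T i \<subseteq> V - W"
    and disj: "disjoint_family_on T Ix" and cover: "V \<subseteq> W \<union> (\<Union>i\<in>Ix. T i)"
    and up: "\<And>i f s. i \<in> Ix \<Longrightarrow> f \<in> T i \<Longrightarrow> f + s \<notin> W \<Longrightarrow>
      \<exists>i'\<in>Ix. f + s \<in> T i' \<and> (i' = i \<or> key i' < key i)"
  shows "induced_by_prime_filtration M Ix (\<lambda>i. \<phi> (mon (e i))) Z"
proof -
  obtain \<sigma> m where \<sigma>: "bij_betw \<sigma> {1..m} Ix"
    and less: "\<And>k l. k \<in> {1..m} \<Longrightarrow> l \<in> {1..m} \<Longrightarrow> key (\<sigma> k) < key (\<sigma> l) \<Longrightarrow> k < (l::nat)"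
    using finite_enumeration_by_key[OF fin, of key] by metis
  have \<sigma>_Ix: "\<sigma> k \<in> Ix" if "k \<in> {1..m}" for k using \<sigma> that by (auto simp: bij_betw_def)
  \<comment> \<open>Including \<open>W\<close> makes \<open>U 0\<close> equal to \<open>W\<close>,
    whose image is the zero submodule.\<close>
  define U where "U k = W \<union> (\<Union>l\<in>{1..k}. T (\<sigma> l))" for k
  define F where "F k = \<phi> ` mspan (U k)" for k
  define P :: "nat \<Rightarrow> ('k, 'n) mpol set" where "P k = mspan (- mon_supported (Z (\<sigma> k)))" for k
  define a where "a k = (\<chi> j. int (e (\<sigma> k) $ j))" for k
  have U_V: "U k \<subseteq> V" and W_U: "W \<subseteq> U k" if "k \<le> m" for k
    using that sub \<sigma>_Ix W_subset by (fastforce simp: U_def)+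
  have U_mono: "U k \<subseteq> U l" if "k \<le> l" for k l
    using that by (fastforce simp: U_def)
  have U_up: "up_closed (U k)" if k: "k \<le> m" for k
    unfolding up_closed_def
  proof (intro ballI allI)
    fix f s assume "f \<in> U k"
    then consider "f \<in> W" | l where "l \<in> {1..k}" "f \<in> T (\<sigma> l)" by (auto simp: U_def)
    then show "f + s \<in> U k"
    proof cases
      case 1
      then show ?thesis using up_W by (auto simp: up_closed_def U_def)
    next
      case 2
      then have l: "l \<in> {1..m}" using k by auto
      show ?thesis
      proof (cases "f + s \<in> W")
        case False
        obtain i where i: "i \<in> Ix" "f + s \<in> T i" "i = \<sigma> l \<or> key i < key (\<sigma> l)"
          using up[OF \<sigma>_Ix[OF l] 2(2) False] by blast
        then obtain l' where l': "l' \<in> {1..m}" "i = \<sigma> l'" using \<sigma> by (auto simp: bij_betw_def)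
        have "l' \<le> l"
          using i(3) less[OF l'(1) l] inj_onD[OF bij_betw_imp_inj_on[OF \<sigma>] _ l'(1) l] l'(2) by auto
        then have "l' \<in> {1..k}" using l' 2 by auto
        then show ?thesis using i l' by (auto simp: U_def)
      qed (simp add: U_def)
    qed
  qed
  have e_T: "e i \<in> T i" for i
    using imageI[OF zero_mon_supported[of "Z i"], of "(+) (e i)"] by (simp add: T_def)
  have step: "T (\<sigma> k) \<inter> U (k - 1) = {}" "U k = U (k - 1) \<union> T (\<sigma> k)" if k: "k \<in> {1..m}" for k
  proof -
    have "T (\<sigma> k) \<inter> T (\<sigma> l) = {}" if l: "l \<in> {1..k - 1}" for l
    proof -
      have lm: "l \<in> {1..m}" "k \<noteq> l" using k l by auto
      then have "\<sigma> k \<noteq> \<sigma> l"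
        using inj_onD[OF bij_betw_imp_inj_on[OF \<sigma>] _ k lm(1)] by blast
      then show ?thesis
        using disj \<sigma>_Ix[OF k] \<sigma>_Ix[OF lm(1)] unfolding disjoint_family_on_def by blast
    qed
    then show "T (\<sigma> k) \<inter> U (k - 1) = {}" using sub[OF \<sigma>_Ix[OF k]] unfolding U_def by blast
    have "{1..k} = insert k {1..k - 1}" using k by auto
    then show "U k = U (k - 1) \<union> T (\<sigma> k)" unfolding U_def by auto
  qed
  have quot: "monomial_presentation (subquot M (F k) (F (k - 1))) (U k) (U (k - 1)) (\<lambda>p. F (k - 1) +> \<phi> p)"
    if k: "k \<in> {1..m}" for k
  proof -
    have le: "k \<le> m" "k - 1 \<le> m" using k by auto
    \<comment> \<open>Two stages: \<open>F k\<close> is presented as a submodule of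
      \<open>M\<close>, and then its quotient by \<open>F (k - 1)\<close> is formed.\<close>
    have "monomial_presentation (sub_gmod M (F k)) (U k) W \<phi>"
      unfolding F_def using U_V U_up le W_U by (intro sub_presentation)
    then have "monomial_presentation (subquot M (F k) (F (k - 1))) (U k) (U (k - 1))
        (\<lambda>p. F (k - 1) +>\<^bsub>sub_gmod M (F k)\<^esub> \<phi> p)"
      unfolding F_def[of "k - 1"] using U_up le W_U U_mono[of "k - 1" k]
      by (intro monomial_presentation.quot_presentation) auto
    then show ?thesis by (simp add: a_r_coset_sub_gmod)
  qed
  have e_U: "e (\<sigma> k) \<in> U k" and e_le: "\<And>f. f \<in> U k - U (k - 1) \<Longrightarrow> e (\<sigma> k) \<le> f" if "k \<in> {1..m}" for k
    using step[OF that] e_T by (auto simp: T_def vec_le_iff_add)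
  have "prime_filtration M m F P a"
    unfolding prime_filtration_def
  proof (intro conjI ballI)
    have "F 0 = \<phi> ` mspan W" by (simp add: F_def U_def)
    also have "\<dots> = {\<phi> 0}"
    proof -
      have "\<phi> p = \<phi> 0" if "p \<in> mspan W" for p
        using that mspan_V[OF W_subset that] by (simp add: eq_iff)
      then show ?thesis using mspan_zero by blast
    qed
    finally show "F 0 = {\<zero>}" by (simp add: zero_eq)
    have "(\<Union>i\<in>Ix. T i) = (\<Union>l\<in>{1..m}. T (\<sigma> l))"
      using \<sigma> by (auto simp: bij_betw_def)
    then have "U m = V" using cover U_V[of m] by (auto simp: U_def)
    then show "F m = carrier M" by (simp add: F_def carrier_eq)
  next
    fix k assume "k \<in> {0..m}"
    then show "graded_submodule M (F k)"
      unfolding F_def using U_V W_U U_up by (intro graded_submodule_image) auto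
  next
    fix k assume k: "k \<in> {1..m}"
    show "F (k - 1) \<subset> F k"
    proof
      show "F (k - 1) \<subseteq> F k" unfolding F_def by (intro image_mono mspan_mono U_mono) simp
      \<comment> \<open>A representative of this class in the smaller span would need coefficient 1
        at \<open>e (\<sigma> k)\<close>, an exponent outside both \<open>W\<close> and
        \<open>U (k - 1)\<close>.\<close>
      have "\<phi> (mon (e (\<sigma> k))) \<notin> F (k - 1)"
      proof
        assume "\<phi> (mon (e (\<sigma> k))) \<in> F (k - 1)"
        then obtain q where q: "\<phi> (mon (e (\<sigma> k))) = \<phi> q" "q \<in> mspan (U (k - 1))" by (auto simp: F_def)
        have nU: "e (\<sigma> k) \<notin> U (k - 1)" "e (\<sigma> k) \<notin> W"
          using step(1)[OF k] e_T[of "\<sigma> k"] by (auto simp: U_def)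
        have "Poly_Mapping.lookup (mon (e (\<sigma> k))) (e (\<sigma> k)) = Poly_Mapping.lookup q (e (\<sigma> k))"
          using q nU mspan_V[OF U_V q(2)] e_U[OF k] U_V[of k] k
          by (subst (asm) eq_iff_lookup) auto
        then show False using mspan_lookup[OF q(2) nU(1)] by (simp add: mon_def)
      qed
      moreover have "\<phi> (mon (e (\<sigma> k))) \<in> F k" using e_U[OF k] by (simp add: F_def)
      ultimately show "F (k - 1) \<noteq> F k" by blast
    qed
    show "monomial_prime (P k)" unfolding P_def by (rule monomial_prime_variables)
    have "monomial_presentation (quot_gmod pol_gmod (P k)) UNIV (- mon_supported (Z (\<sigma> k)))
        (\<lambda>p. P k +>\<^bsub>pol_gmod\<^esub> p)"
      using monomial_presentation.quot_presentation[OF pol_gmod_presentation _ _ up_closed_compl_mon_supported]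
      by (simp add: P_def)
    \<comment> \<open>In terms of ideals: the colon of span U (k - 1) by x^e is the prime
      \<open>P k\<close>. A multiple of x^e that leaves the new piece stays in the up-closed
      \<open>U k\<close> and hence lands in \<open>U (k - 1)\<close>.\<close>
    moreover have "e (\<sigma> k) + f \<in> U (k - 1) \<longleftrightarrow> f \<in> - mon_supported (Z (\<sigma> k))" for f
    proof
      assume "e (\<sigma> k) + f \<in> U (k - 1)"
      then show "f \<in> - mon_supported (Z (\<sigma> k))" using step(1)[OF k] by (auto simp: T_def)
    next
      assume "f \<in> - mon_supported (Z (\<sigma> k))"
      then have "e (\<sigma> k) + f \<notin> T (\<sigma> k)" by (auto simp: T_def)
      moreover have "e (\<sigma> k) + f \<in> U k" using U_up[of k] k e_U[OF k] by (auto simp: up_closed_def)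
      ultimately show "e (\<sigma> k) + f \<in> U (k - 1)" using step(2)[OF k] by blast
    qed
    ultimately show "gmod_iso (subquot M (F k) (F (k - 1))) (shift_gmod (quot_gmod pol_gmod (P k)) (a k))"
      unfolding a_def using quot[OF k] e_U[OF k] e_le[OF k] by (intro gmod_iso_shift)
  qed
  moreover have "stanley_decomposition M Ix (\<lambda>i. \<phi> (mon (e i))) Z"
    using fin sub disj cover unfolding T_def by (rule stanley_decomposition_mon)
  moreover have "\<phi> (mon (e (\<sigma> k))) \<in> F k \<inter> hcomp M (a k)" if k: "k \<in> {1..m}" for k
  proof
    show "\<phi> (mon (e (\<sigma> k))) \<in> F k" using e_U[OF k] by (simp add: F_def)
    have "e (\<sigma> k) \<in> V" using e_U[OF k] U_V[of k] k by auto
    then show "\<phi> (mon (e (\<sigma> k))) \<in> hcomp M (a k)"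
      unfolding hcomp_eq a_def by (intro imageI IntI mon_graded) simp
  qed
  moreover have "carrier (subquot M (F k) (F (k - 1))) =
      range (\<lambda>p. p \<odot>\<^bsub>subquot M (F k) (F (k - 1))\<^esub> (F (k - 1) +> \<phi> (mon (e (\<sigma> k)))))"
    if k: "k \<in> {1..m}" for k
    using quot[OF k] e_U[OF k] e_le[OF k] by (rule monomial_presentation.carrier_cyclic)
  moreover have "Z (\<sigma> k) = {j. mon (axis j 1) \<notin> P k}" for k
    by (auto simp: P_def mon_supported_def axis_def)
  ultimately show ?thesis
    unfolding induced_by_prime_filtration_def using \<sigma> by blast
qed

end

section \<open>Ordering the pieces of the decomposition\<close>

locale ordered_interval_partition =
  fixes A B :: "(nat ^ 'n::finite) set" and g :: "nat ^ 'n" and r :: nat and c d :: "nat \<Rightarrow> nat ^ 'n"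
  assumes A_le: "\<forall>a\<in>A. a \<le> g" and B_le: "\<forall>b\<in>B. b \<le> g"
    and partition: "interval_partition (char_poset A B g) r c d"
    and ideals: "\<forall>j\<in>{1..r}. poset_ideal (char_poset A B g)
           (\<Union>i\<in>{1..j}. poset_interval (char_poset A B g) (c i) (d i))"
begin

abbreviation "Pg \<equiv> char_poset A B g"
abbreviation "Iv i \<equiv> poset_interval Pg (c i) (d i)"
abbreviation "Ix \<equiv> DP_index Pg g r c d"
abbreviation "T \<equiv> \<lambda>(i, e). (+) e ` mon_supported (Z_of g (d i))"

section \<open>Truncation and the characteristic poset\<close>

definition trunc :: "nat ^ 'n \<Rightarrow> nat ^ 'n" where
  "trunc f = (\<chi> j. min (f $ j) (g $ j))"

lemma trunc_le: "trunc f \<le> g" "trunc f \<le> f"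
  by (simp_all add: trunc_def less_eq_vec_def)

lemma le_trunc: "a \<le> g \<Longrightarrow> a \<le> trunc f \<longleftrightarrow> a \<le> f"
  by (simp add: trunc_def less_eq_vec_def)

lemma trunc_mono: "f \<le> f' \<Longrightarrow> trunc f \<le> trunc f'"
  by (auto simp: trunc_def less_eq_vec_def min_le_iff_disj)

text \<open>Every generator lies below \<open>g\<close>, so x^f and its truncation are divisible by
  the same generators of I and of J.\<close>

lemma trunc_char_poset: "trunc f \<in> Pg \<longleftrightarrow> f \<in> up_set A - up_set B"
  using A_le B_le by (auto simp: char_poset_def up_set_def trunc_le le_trunc)

text \<open>Multiples of elements of I stay in I, and divisors of monomials outside J stay outside
  J. Consequently the intervals of the poset are full boxes and can be tested coordinate by
  coordinate.\<close>

lemma char_poset_convex: "a \<in> Pg \<Longrightarrow> b \<in> Pg \<Longrightarrow> a \<le> f \<Longrightarrow> f \<le> b \<Longrightarrow> f \<in> Pg"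
  unfolding char_poset_def by (blast intro: order_trans)

lemma interval_ends: "i \<in> {1..r} \<Longrightarrow> c i \<in> Pg \<and> d i \<in> Pg \<and> c i \<le> d i"
  using partition by (simp add: interval_partition_def)

lemma interval_ends_le:
  assumes "i \<in> {1..r}"
  shows "c i $ j \<le> d i $ j" "d i $ j \<le> g $ j" "c i $ j \<le> g $ j"
  using interval_ends[OF assms] by (auto simp: char_poset_def less_eq_vec_def intro: order_trans)

lemma interval_iff: "i \<in> {1..r} \<Longrightarrow> f \<in> Iv i \<longleftrightarrow> c i \<le> f \<and> f \<le> d i"
  using interval_ends char_poset_convex by (auto simp: poset_interval_def)

lemma char_poset_cover: "f \<in> Pg \<longleftrightarrow> (\<exists>i\<in>{1..r}. f \<in> Iv i)"
proof -
  have "Pg = (\<Union>i\<in>{1..r}. Iv i)" using partition by (simp add: interval_partition_def)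
  then show ?thesis by blast
qed

lemma interval_unique: "i \<in> {1..r} \<Longrightarrow> i' \<in> {1..r} \<Longrightarrow> f \<in> Iv i \<Longrightarrow> f \<in> Iv i' \<Longrightarrow> i = i'"
  using partition unfolding interval_partition_def disjoint_family_on_def by blast

lemma Ix_D:
  assumes "(i, e) \<in> Ix"
  shows "i \<in> {1..r}" "c i $ j \<le> e $ j" "e $ j \<le> d i $ j" "j \<in> Z_of g (d i) \<Longrightarrow> e $ j = c i $ j"
  using assms by (auto simp: DP_index_def poset_interval_def less_eq_vec_def)

lemma finite_Ix: "finite Ix"
proof -
  have "{f. f \<le> g} \<subseteq> vec_lambda ` (\<Pi>\<^sub>E j\<in>UNIV. {..g $ j})"
  proof
    fix f assume "f \<in> {f. f \<le> g}"
    then have "($) f \<in> (\<Pi>\<^sub>E j\<in>UNIV. {..g $ j})" by (auto simp: less_eq_vec_def)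
    then show "f \<in> vec_lambda ` (\<Pi>\<^sub>E j\<in>UNIV. {..g $ j})" by (intro image_eqI[of _ _ "($) f"]) simp_all
  qed
  then have "finite {f. f \<le> g}" by (rule finite_subset) (intro finite_imageI finite_PiE; simp)
  moreover have "Ix \<subseteq> {1..r} \<times> {f. f \<le> g}"
    by (auto simp: DP_index_def poset_interval_def char_poset_def)
  ultimately show ?thesis by (meson finite_SigmaI finite_atLeastAtMost finite_subset)
qed

text \<open>On Z the upper end is \<open>g\<close>, so truncation satisfies the upper bound
  automatically, and the lower bound \<open>c i\<close> coincides with \<open>e\<close>. Off Z,
  \<open>f\<close> takes the values of \<open>e\<close>, which lie between \<open>c i\<close> and
  \<open>d i\<close> and are untouched by truncation.\<close>

lemma mem_piece_iff:
  assumes "(i, e) \<in> Ix"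
  shows "f \<in> T (i, e) \<longleftrightarrow> trunc f \<in> Iv i \<and> (\<forall>j. j \<notin> Z_of g (d i) \<longrightarrow> f $ j = e $ j)"
proof -
  have "f \<in> T (i, e) \<longleftrightarrow> (\<forall>j. e $ j \<le> f $ j \<and> (j \<notin> Z_of g (d i) \<longrightarrow> f $ j = e $ j))"
  proof
    assume *: "\<forall>j. e $ j \<le> f $ j \<and> (j \<notin> Z_of g (d i) \<longrightarrow> f $ j = e $ j)"
    then have "f = e + (\<chi> j. f $ j - e $ j)" by (simp add: vec_eq_iff)
    moreover have "(\<chi> j. f $ j - e $ j) \<in> mon_supported (Z_of g (d i))"
      using * by (auto simp: mon_supported_def)
    ultimately show "f \<in> T (i, e)" by auto
  qed (auto simp: mon_supported_def)
  also have "\<dots> \<longleftrightarrow> (\<forall>j. c i $ j \<le> min (f $ j) (g $ j) \<and> min (f $ j) (g $ j) \<le> d i $ j \<and>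
      (j \<notin> Z_of g (d i) \<longrightarrow> f $ j = e $ j))"
  proof (rule all_cong1)
    fix j
    show "(e $ j \<le> f $ j \<and> (j \<notin> Z_of g (d i) \<longrightarrow> f $ j = e $ j)) \<longleftrightarrow>
        (c i $ j \<le> min (f $ j) (g $ j) \<and> min (f $ j) (g $ j) \<le> d i $ j \<and>
        (j \<notin> Z_of g (d i) \<longrightarrow> f $ j = e $ j))"
      using Ix_D(2-)[OF assms, of j] interval_ends_le[OF Ix_D(1)[OF assms], of j]
      by (cases "j \<in> Z_of g (d i)") (auto simp: Z_of_def)
  qed
  also have "\<dots> \<longleftrightarrow> trunc f \<in> Iv i \<and> (\<forall>j. j \<notin> Z_of g (d i) \<longrightarrow> f $ j = e $ j)"
    unfolding interval_iff[OF Ix_D(1)[OF assms]] by (auto simp: trunc_def less_eq_vec_def)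
  finally show ?thesis .
qed

lemma piece_exists:
  assumes i: "i \<in> {1..r}" and f: "trunc f \<in> Iv i"
  obtains e where "(i, e) \<in> Ix" "f \<in> T (i, e)"
proof -
  \<comment> \<open>Both cases are forced: the values on Z by the index set, those off Z by
    \<open>mem_piece_iff\<close>. Off Z, \<open>d i\<close> lies strictly below \<open>g\<close>, so
    the bound on \<open>trunc f\<close> already bounds \<open>f\<close>.\<close>
  define e where "e = (\<chi> j. if j \<in> Z_of g (d i) then c i $ j else f $ j)"
  have "c i $ j \<le> e $ j \<and> e $ j \<le> d i $ j" for j
  proof -
    have "c i $ j \<le> min (f $ j) (g $ j)" "min (f $ j) (g $ j) \<le> d i $ j"
      using f by (simp_all add: interval_iff[OF i] trunc_def less_eq_vec_def)
    then show ?thesis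
      using interval_ends_le[OF i, of j] by (auto simp: e_def Z_of_def)
  qed
  then have "e \<in> Iv i" unfolding interval_iff[OF i] by (simp add: less_eq_vec_def)
  then have e: "(i, e) \<in> Ix" using i by (simp add: DP_index_def e_def)
  have "f \<in> T (i, e)" unfolding mem_piece_iff[OF e] using f by (simp add: e_def)
  with e show thesis by (rule that)
qed

lemma piece_subset:
  assumes "x \<in> Ix"
  shows "T x \<subseteq> up_set A - up_set B"
proof
  fix f assume f: "f \<in> T x"
  obtain i e where x: "x = (i, e)" by fastforce
  have "trunc f \<in> Iv i" "i \<in> {1..r}"
    using f mem_piece_iff[of i e f] Ix_D(1)[of i e] assms unfolding x by blast+
  then have "trunc f \<in> Pg" using char_poset_cover by blast
  then show "f \<in> up_set A - up_set B" by (simp only: trunc_char_poset)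
qed

text \<open>The truncation of \<open>f\<close> determines the interval, since the intervals are
  disjoint; then \<open>e\<close> is determined by \<open>c i\<close> on Z and by \<open>f\<close>
  off Z.\<close>

lemma piece_unique:
  assumes "(i, e) \<in> Ix" "(i', e') \<in> Ix" "f \<in> T (i, e)" "f \<in> T (i', e')"
  shows "(i, e) = (i', e')"
proof -
  have "i = i'"
    using assms interval_unique[OF Ix_D(1) Ix_D(1)] by (simp only: mem_piece_iff) blast
  moreover have "e = e'"
    unfolding vec_eq_iff
  proof
    fix j
    show "e $ j = e' $ j"
    proof (cases "j \<in> Z_of g (d i)")
      case True
      then show ?thesis using Ix_D(4)[OF assms(1)] Ix_D(4)[OF assms(2)] \<open>i = i'\<close> by simp
    next
      case False
      then show ?thesis
        using assms(3)[unfolded mem_piece_iff[OF assms(1)]] assms(4)[unfolded mem_piece_iff[OF assms(2)]] \<open>i = i'\<close>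
        by simp
    qed
  qed
  ultimately show ?thesis by simp
qed

lemma piece_cover: "up_set A \<subseteq> up_set B \<union> (\<Union>x\<in>Ix. T x)"
proof
  fix f assume "f \<in> up_set A"
  show "f \<in> up_set B \<union> (\<Union>x\<in>Ix. T x)"
  proof (cases "f \<in> up_set B")
    case False
    then obtain i where "i \<in> {1..r}" "trunc f \<in> Iv i"
      using \<open>f \<in> up_set A\<close> trunc_char_poset char_poset_cover by blast
    then show ?thesis by (rule piece_exists) blast
  qed simp
qed

text \<open>The factor exceeds every \<open>|e|\<close>, so \<open>key\<close> orders lexicographically by \<open>i\<close>, then by decreasing \<open>|e|\<close>.\<close>
definition key :: "nat \<times> (nat ^ 'n) \<Rightarrow> int" where
  "key = (\<lambda>(i, e). int i * (int (\<Sum>j\<in>UNIV. g $ j) + 1) - int (\<Sum>j\<in>UNIV. e $ j))"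

lemma piece_up:
  assumes x: "x \<in> Ix" "f \<in> T x" and fs: "f + s \<notin> up_set B"
  shows "\<exists>y\<in>Ix. f + s \<in> T y \<and> (y = x \<or> key y < key x)"
proof -
  obtain i e where x_eq: "x = (i, e)" by fastforce
  note ie = x(1)[unfolded x_eq] and f = x(2)[unfolded x_eq mem_piece_iff[OF x(1)[unfolded x_eq]]]
  note i = Ix_D(1)[OF ie]
  have "f \<in> up_set A" using piece_subset[OF x(1)] x(2) by blast
  then have "f + s \<in> up_set A" using up_closed_up_set by (auto simp: up_closed_def)
  then have "trunc (f + s) \<in> Pg" using fs by (simp add: trunc_char_poset)
  moreover have "trunc f \<le> trunc (f + s)" by (intro trunc_mono) (auto simp: vec_le_iff_add)
  \<comment> \<open>The union of the first \<open>i\<close> intervals is upward closed in the poset,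
    so the larger element \<open>trunc (f + s)\<close> lies in an interval with number at most
    \<open>i\<close>.\<close>
  moreover have "trunc f \<in> (\<Union>k\<in>{1..i}. Iv k)" using f i by auto
  moreover have "poset_ideal Pg (\<Union>k\<in>{1..i}. Iv k)" using ideals i by blast
  ultimately have "trunc (f + s) \<in> (\<Union>k\<in>{1..i}. Iv k)"
    unfolding poset_ideal_def by blast
  then obtain k where k: "k \<in> {1..i}" "trunc (f + s) \<in> Iv k" by blast
  then have kr: "k \<in> {1..r}" using i by auto
  obtain e' where e': "(k, e') \<in> Ix" "f + s \<in> T (k, e')" by (rule piece_exists[OF kr k(2)])
  note fs' = e'(2)[unfolded mem_piece_iff[OF e'(1)]]
  have "(k, e') = x \<or> key (k, e') < key x"
  proof (cases "k = i")
    case True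
    \<comment> \<open>Within one interval, \<open>e\<close> and \<open>e'\<close> both agree with
      \<open>c i\<close> on Z, while off Z they copy \<open>f\<close> and
      \<open>f + s\<close>.\<close>
    have le: "e $ j \<le> e' $ j" for j
    proof (cases "j \<in> Z_of g (d i)")
      case True
      then show ?thesis using Ix_D(4)[OF ie] Ix_D(4)[OF e'(1)] \<open>k = i\<close> by simp
    next
      case False
      then have "e $ j = f $ j" "e' $ j = f $ j + s $ j" using f fs' \<open>k = i\<close> by auto
      then show ?thesis by simp
    qed
    show ?thesis
    proof (cases "e = e'")
      case False
      then obtain j where "e $ j \<noteq> e' $ j" by (auto simp: vec_eq_iff)
      then have "(\<Sum>j\<in>UNIV. e $ j) < (\<Sum>j\<in>UNIV. e' $ j)"
        using le by (intro sum_strict_mono_ex1) (auto simp: order.strict_iff_order)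
      then show ?thesis using True by (simp add: key_def x_eq del: of_nat_sum)
    qed (simp add: x_eq True)
  next
    case False
    \<comment> \<open>Passing from \<open>k\<close> to the larger \<open>i\<close> raises the first
      part of the key by at least N + 1. Subtracting |e| takes back at most N, and subtracting |e'|
      only lowers the key of \<open>(k, e')\<close>.\<close>
    let ?N = "int (\<Sum>j\<in>UNIV. g $ j)"
    have "(\<Sum>j\<in>UNIV. e $ j) \<le> (\<Sum>j\<in>UNIV. g $ j)"
      using Ix_D(3)[OF ie] interval_ends_le(2)[OF i] by (intro sum_mono) (meson order_trans)
    then have "int (\<Sum>j\<in>UNIV. e $ j) \<le> ?N" by (simp only: of_nat_le_iff)
    moreover have "(int k + 1) * (?N + 1) \<le> int i * (?N + 1)"
    proof (rule mult_right_mono)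
      show "int k + 1 \<le> int i" using False k(1) by simp
      show "0 \<le> ?N + 1" using of_nat_0_le_iff[of "\<Sum>j\<in>UNIV. g $ j", where ?'a = int] by linarith
    qed
    ultimately have "key (k, e') < key x"
      by (simp add: key_def x_eq algebra_simps del: of_nat_sum)
    then show ?thesis ..
  qed
  then show ?thesis using e' by blast
qed

end

theorem theorem2p2:
  fixes I J :: "('k::field, 'n::finite) mpol set"
    and A B :: "(nat ^ 'n) set"
    and g :: "nat ^ 'n"
    and r :: nat
    and c d :: "nat \<Rightarrow> nat ^ 'n"
  assumes "finite A" and "I = gen_mon_ideal A"
    and "finite B" and "J = gen_mon_ideal B"
    and "J \<subset> I"
    and "\<forall>a\<in>A. a \<le> g" and "\<forall>b\<in>B. b \<le> g"
    and "interval_partition (char_poset A B g) r c d"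
    and "\<forall>j\<in>{1..r}. poset_ideal (char_poset A B g)
           (\<Union>i\<in>{1..j}. poset_interval (char_poset A B g) (c i) (d i))"
  shows "induced_by_prime_filtration (subquot pol_gmod I J)
           (DP_index (char_poset A B g) g r c d) (DP_elt J) (DP_vars g d)"
proof -
  interpret ordered_interval_partition A B g r c d
    using assms(6-9) by unfold_locales
  have I: "I = mspan (up_set A)" and J: "J = mspan (up_set B)"
    using assms(2,4) by (simp_all add: gen_mon_ideal_eq)
  have "up_set B \<subseteq> up_set A"
  proof
    fix b assume "b \<in> up_set B"
    then have "mon b \<in> I" using assms(5) J by auto
    then show "b \<in> up_set A" by (simp add: I)
  qed
  have "monomial_presentation (sub_gmod pol_gmod I) (up_set A) {} (\<lambda>p. p)"
    using monomial_presentation.sub_presentation[OF pol_gmod_presentation _ _ up_closed_up_set]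
    by (simp add: I)
  then have "monomial_presentation (subquot pol_gmod I J) (up_set A) (up_set B)
      (\<lambda>p. J +>\<^bsub>sub_gmod pol_gmod I\<^esub> p)"
    using monomial_presentation.quot_presentation[OF _ _ \<open>up_set B \<subseteq> up_set A\<close> up_closed_up_set]
    by (fastforce simp: J)
  then interpret M: monomial_presentation "subquot pol_gmod I J" "up_set A" "up_set B"
      "\<lambda>p. J +>\<^bsub>pol_gmod\<^esub> p"
    by (simp add: a_r_coset_sub_gmod)
  \<comment> \<open>Rewrites the pieces as a function of the index pair, with exponent
    \<open>snd x\<close>, to match the form of the general filtration lemma.\<close>
  have T: "T = (\<lambda>x. (+) (snd x) ` mon_supported (DP_vars g d x))"
    by (auto simp: DP_vars_def)
  have disj: "disjoint_family_on T Ix"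
    unfolding disjoint_family_on_def
  proof (intro ballI impI)
    fix x y assume "x \<in> Ix" "y \<in> Ix" "x \<noteq> y"
    then show "T x \<inter> T y = {}" using piece_unique by (metis disjoint_iff surj_pair)
  qed
  have "induced_by_prime_filtration (subquot pol_gmod I J) Ix
      (\<lambda>x. J +>\<^bsub>pol_gmod\<^esub> mon (snd x)) (DP_vars g d)"
    using finite_Ix piece_subset disj piece_cover piece_up unfolding T
    by (rule M.induced_by_prime_filtration_mon)
  moreover have "(\<lambda>x. J +>\<^bsub>pol_gmod\<^esub> mon (snd x)) = DP_elt J"
    by (auto simp: DP_elt_def)
  ultimately show ?thesis by simp
qed

end
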